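(* Consider the structural Berkson logistic regression model with unknown error variance $\tau^2$. Suppose the distribution of $X^{\rm obs}_1$ is not concentrated at three (or less) points, i.e. there is no set $A\subset\mathbb{R}$ with at most three elements such that $P(X^{\rm obs}_1\in A)=1$. Then the parameters $\vec\beta$ and $\beta_1^2\tau^2$ are identifiable; that is, if $(\vec\beta^{(1)},(\tau^{(1)})^2)$ and $(\vec\beta^{(2)},(\tau^{(2)})^2)$ are two parameter sets in $\mathbb{R}^2\times[0,\infty)$ for which the same bivariate distribution of $(X^{\rm obs}_1,Y_1)$ is obtained, then $\vec\beta^{(1)}=\vec\beta^{(2)}$ and $(\beta_1^{(1)})^2(\tau^{(1)})^2=(\beta_1^{(2)})^2(\tau^{(2)})^2$.
   Context: Structural Berkson logistic regression model: $(X^{\rm obs}_n,X_n,Y_n)$, $n=1,2,\dots$, are i.i.d. random triples. The surrogate regressor $X^{\rm obs}_n$ is a real random variable; the true regressor is $X_n=X^{\rm obs}_n+U_n$, where $U_n\sim N(0,\tau^2)$ is independent of $X^{\rm obs}_n$, $\tau^2\ge 0$ (for $\tau^2=0$, $U_n=0$ almost surely). The response $Y_n\in\{0,1\}$ satisfies $$P(Y_n=1\mid X^{\rm obs}_n,X_n)=\frac{\exp(\beta_0+\beta_1X_n)}{1+\exp(\beta_0+\beta_1X_n)}.$$ The pairs $(X^{\rm obs}_n,Y_n)$ are observed; the $X_n$ are not. The unknown parameters are $\vec\beta=(\beta_0,\beta_1)^\top\in\mathbb{R}^2$ and $\tau^2\ge 0$. A function of the parameters is identifiable if it takes equal values at any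 two parameter sets giving the same distribution of the observations. *)

theory Defs
  imports "HOL-Probability.Probability"
begin

text \<open>
  The centred normal distribution with variance \<open>v \<ge> 0\<close>; \<open>normal_density\<close> takes the
  standard deviation and does not cover the degenerate case \<open>v = 0\<close>, which is the point
  mass at \<open>0\<close>.
\<close>
definition centered_normal :: "real \<Rightarrow> real measure" where
  "centered_normal v =
     (if v = 0 then return borel 0
      else density lborel (\<lambda>x. ennreal (normal_density 0 (sqrt v) x)))"

text \<open>
  The coefficient vector is \<open>\<beta> = (\<beta>\<^sub>0, \<beta>\<^sub>1)\<close> and \<open>\<tau>sq\<close> is the error variance itself, not its
  root. Observations are indexed from \<open>1\<close>; the values of the sequences at index \<open>0\<close> are
  irrelevant. In \<open>response_logistic\<close>, conditioning is on the \<open>\<sigma>\<close>-algebra generated by the pair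
  of the surrogate and the true regressor.
\<close>
locale berkson_logistic = prob_space M
  for M :: "'a measure" +
  fixes Xobs X U Y :: "nat \<Rightarrow> 'a \<Rightarrow> real"
    and \<beta> :: "real \<times> real"
    and \<tau>sq :: real
  assumes \<tau>sq_nonneg: "\<tau>sq \<ge> 0"
    and rv_Xobs: "\<And>n. n \<ge> 1 \<Longrightarrow> Xobs n \<in> borel_measurable M"
    and rv_X: "\<And>n. n \<ge> 1 \<Longrightarrow> X n \<in> borel_measurable M"
    and rv_U: "\<And>n. n \<ge> 1 \<Longrightarrow> U n \<in> borel_measurable M"
    and rv_Y: "\<And>n. n \<ge> 1 \<Longrightarrow> Y n \<in> borel_measurable M"
    and indep_triples:
      "indep_vars (\<lambda>_. borel) (\<lambda>n \<omega>. (Xobs n \<omega>, X n \<omega>, Y n \<omega>)) {1..}"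
    and identically_distributed:
      "\<And>n. n \<ge> 1 \<Longrightarrow> distr M borel (\<lambda>\<omega>. (Xobs n \<omega>, X n \<omega>, Y n \<omega>))
                     = distr M borel (\<lambda>\<omega>. (Xobs 1 \<omega>, X 1 \<omega>, Y 1 \<omega>))"
    and true_regressor:
      "\<And>n \<omega>. n \<ge> 1 \<Longrightarrow> \<omega> \<in> space M \<Longrightarrow> X n \<omega> = Xobs n \<omega> + U n \<omega>"
    and error_normal: "\<And>n. n \<ge> 1 \<Longrightarrow> distr M borel (U n) = centered_normal \<tau>sq"
    and error_indep: "\<And>n. n \<ge> 1 \<Longrightarrow> indep_var borel (Xobs n) borel (U n)"
    and response_binary: "\<And>n \<omega>. n \<ge> 1 \<Longrightarrow> \<omega> \<in> space M \<Longrightarrow> Y n \<omega> \<in> {0, 1}"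
    and response_logistic:
      "\<And>n. n \<ge> 1 \<Longrightarrow>
         AE \<omega> in M.
           real_cond_exp M (vimage_algebra (space M) (\<lambda>\<omega>. (Xobs n \<omega>, X n \<omega>)) borel)
             (indicator {\<omega> \<in> space M. Y n \<omega> = 1}) \<omega>
           = exp (fst \<beta> + snd \<beta> * X n \<omega>) / (1 + exp (fst \<beta> + snd \<beta> * X n \<omega>))"

end

theory Submission imports Defs "HOL-Real_Asymp.Real_Asymp"
begin

text \<open>
  Given the surrogate \<open>x\<close>, the response is \<open>1\<close> with probability \<open>L(\<beta>\<^sub>0 + \<beta>\<^sub>1 x, \<bar>\<beta>\<^sub>1\<bar> \<tau>)\<close>, where
  \<open>L(t, s) = E \<Lambda>(t + s Z)\<close>, \<open>\<Lambda>\<close> is the logistic function and \<open>Z\<close> is standard normal. So two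
  parameter sets with the same observations give an equality of the form
  \<open>L(t, s) = L(c + k t, s')\<close> at four or more points \<open>t\<close>, and everything rests on refuting this for
  \<open>s < s'\<close>. By the heat equation a level curve \<open>q\<close> of \<open>L\<close>, i.e. \<open>L(q(s), s)\<close> constant, satisfies
  \<open>q' = - s G(q, s)\<close> with \<open>G = L\<^sub>t\<^sub>t / L\<^sub>t\<close>. The function \<open>G(\<cdot>, s)\<close> is strictly convex on
  \<open>[0, \<infinity>)\<close>, so the ratio \<open>(q\<^sub>3 - q\<^sub>2) / (q\<^sub>2 - q\<^sub>1)\<close> of the gaps between three nonnegative level
  curves strictly decreases in \<open>s\<close>. Affine maps preserve this ratio; hence at most two of the points
  \<open>t\<close> lie on each side of \<open>0\<close>, and two on each side would force both \<open>c > 0\<close> and \<open>c < 0\<close>,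
  because \<open>L(0, s) = 1/2\<close> for all \<open>s\<close>.

  Convexity of \<open>G\<close> is the positivity of the third central moment of the density proportional to
  \<open>p(z) = \<Lambda>'(t + s z) \<phi>(z)\<close> for \<open>t > 0\<close>: around the mean \<open>m\<close>, the function
  \<open>r \<mapsto> ln p(m + r) - ln p(m - r)\<close> vanishes at \<open>0\<close> and is strictly convex for \<open>r > 0\<close>, so
  \<open>p(m + r) - p(m - r)\<close> changes sign once, from negative to positive, at some \<open>r\<^sub>0\<close>, and
  \<open>r (r\<^sup>2 - r\<^sub>0\<^sup>2) (p(m + r) - p(m - r))\<close> is nonnegative.
\<close>

section \<open>Gaussian averages\<close>

text \<open>The mean value inequality bounds the difference quotients by \<open>w\<close>, so
  dominated convergence applies along every sequence of nonzero increments tending to 0.\<close>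

lemma DERIV_lebesgue_integral:
  fixes f f' :: "real \<Rightarrow> 'a \<Rightarrow> real"
  assumes int: "\<And>u. integrable M (f u)"
    and deriv: "\<And>u x. x \<in> space M \<Longrightarrow> ((\<lambda>u. f u x) has_real_derivative f' u x) (at u)"
    and bound: "\<And>u x. x \<in> space M \<Longrightarrow> \<bar>f' u x\<bar> \<le> w x"
    and w: "integrable M w"
  shows "((\<lambda>u. \<integral>x. f u x \<partial>M) has_real_derivative (\<integral>x. f' u x \<partial>M)) (at u)"
proof -
  have [measurable]: "f u \<in> borel_measurable M" for u
    using int by auto
  have lim: "(\<lambda>n. (f (u + h n) x - f u x) / h n) \<longlonglongrightarrow> f' u x"
    if "x \<in> space M" "h \<longlonglongrightarrow> 0" "\<And>n. h n \<noteq> 0" for x h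
    using deriv[OF that(1), of u] that unfolding DERIV_def tendsto_at_iff_sequentially
    by (auto simp: o_def)
  \<comment> \<open>Measurability of \<open>f' u\<close> is derived: on \<open>space M\<close> it
    equals \<open>g\<close>, a limit of measurable difference quotients.\<close>
  define g where "g x = lim (\<lambda>n. (f (u + 1 / real (Suc n)) x - f u x) / (1 / real (Suc n)))" for x
  have g: "g x = f' u x" if "x \<in> space M" for x
    unfolding g_def by (rule limI, rule lim[OF that LIMSEQ_Suc[OF lim_1_over_n]]) auto
  have [measurable]: "g \<in> borel_measurable M"
    unfolding g_def by measurable
  have meas [measurable]: "f' u \<in> borel_measurable M"
    using measurable_cong[of M "f' u" g] g by simp
  have "((\<lambda>h. ((\<integral>x. f (u + h) x \<partial>M) - (\<integral>x. f u x \<partial>M)) / h) \<longlongrightarrow> (\<integral>x. f' u x \<partial>M)) (at 0)"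
    unfolding tendsto_at_iff_sequentially
  proof (intro allI impI)
    fix h :: "nat \<Rightarrow> real"
    assume "\<forall>i. h i \<in> UNIV - {0}" and h0: "h \<longlonglongrightarrow> 0"
    then have hn: "h n \<noteq> 0" for n by auto
    have "(\<lambda>n. \<integral>x. (f (u + h n) x - f u x) / h n \<partial>M) \<longlonglongrightarrow> (\<integral>x. f' u x \<partial>M)"
    proof (rule integral_dominated_convergence)
      show "AE x in M. (\<lambda>n. (f (u + h n) x - f u x) / h n) \<longlonglongrightarrow> f' u x"
        by (rule AE_I2) (rule lim[OF _ h0 hn])
      show "AE x in M. norm ((f (u + h n) x - f u x) / h n) \<le> w x" for n
      proof (rule AE_I2)
        fix x assume x: "x \<in> space M"
        have "norm (f (u + h n) x - f u x) \<le> w x * norm (u + h n - u)"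
          by (rule field_differentiable_bound[where S=UNIV and f'="\<lambda>v. f' v x"])
             (use deriv[OF x] bound[OF x] in auto)
        then show "norm ((f (u + h n) x - f u x) / h n) \<le> w x"
          using hn[of n] by (simp add: field_simps)
      qed
    qed (use w in auto)
    then show "((\<lambda>h. ((\<integral>x. f (u + h) x \<partial>M) - (\<integral>x. f u x \<partial>M)) / h) \<circ> h)
        \<longlonglongrightarrow> (\<integral>x. f' u x \<partial>M)"
      unfolding comp_def integral_divide_zero Bochner_Integration.integral_diff[OF int int] .
  qed
  then show ?thesis
    unfolding DERIV_def .
qed

definition gauss_moment :: "nat \<Rightarrow> (real \<Rightarrow> real) \<Rightarrow> real \<Rightarrow> real \<Rightarrow> real" where
  "gauss_moment k B t s = (\<integral>z. std_normal_density z * z ^ k * B (t + s * z) \<partial>lborel)"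

abbreviation gauss_avg :: "(real \<Rightarrow> real) \<Rightarrow> real \<Rightarrow> real \<Rightarrow> real" where
  "gauss_avg \<equiv> gauss_moment 0"

lemma integrable_gauss_moment:
  assumes B: "continuous_on UNIV B" and bd: "\<And>x. \<bar>B x\<bar> \<le> 1"
  shows "integrable lborel (\<lambda>z. std_normal_density z * z ^ k * B (t + s * z))"
proof (rule Bochner_Integration.integrable_bound[OF integrable_std_normal_moment_abs[of k]])
  have [measurable]: "B \<in> borel_measurable borel"
    using B by (rule borel_measurable_continuous_onI)
  show "(\<lambda>z. std_normal_density z * z ^ k * B (t + s * z)) \<in> borel_measurable lborel"
    by measurable
  show "AE z in lborel. norm (std_normal_density z * z ^ k * B (t + s * z))
          \<le> norm (std_normal_density z * \<bar>z\<bar> ^ k)"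
    using bd by (auto simp: abs_mult power_abs intro!: mult_left_le)
qed

lemma tendsto_gauss_avg:
  assumes B: "continuous_on UNIV B" and bd: "\<And>x. \<bar>B x\<bar> \<le> 1"
    and "t \<longlonglongrightarrow> t0" "s \<longlonglongrightarrow> s0"
  shows "(\<lambda>n. gauss_avg B (t n) (s n)) \<longlonglongrightarrow> gauss_avg B t0 s0"
  unfolding gauss_moment_def
proof (rule integral_dominated_convergence)
  have [measurable]: "B \<in> borel_measurable borel"
    using B by (rule borel_measurable_continuous_onI)
  show "(\<lambda>z. std_normal_density z * z ^ 0 * B (t n + s n * z)) \<in> borel_measurable lborel" for n
    by measurable
  show "(\<lambda>z. std_normal_density z * z ^ 0 * B (t0 + s0 * z)) \<in> borel_measurable lborel"
    by measurable
  show "AE z in lborel. (\<lambda>n. std_normal_density z * z ^ 0 * B (t n + s n * z))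
      \<longlonglongrightarrow> std_normal_density z * z ^ 0 * B (t0 + s0 * z)"
    using assms(3,4)
    by (intro AE_I2 tendsto_intros continuous_on_tendsto_compose[OF B]) auto
  show "AE z in lborel. norm (std_normal_density z * z ^ 0 * B (t n + s n * z))
          \<le> std_normal_density z" for n
    using bd by (auto simp: abs_mult intro!: mult_left_le)
qed simp

lemma continuous_on_gauss_avg:
  assumes B: "continuous_on UNIV B" and bd: "\<And>x. \<bar>B x\<bar> \<le> 1"
  shows "continuous_on UNIV (\<lambda>p. gauss_avg B (fst p) (snd p))"
  unfolding continuous_on_sequentially comp_def
  by (intro ballI allI impI tendsto_gauss_avg[OF B bd] tendsto_fst tendsto_snd) auto

text \<open>Integration by parts, since \<open>z \<phi>(z) = - \<phi>'(z)\<close> for the standard normal density \<open>\<phi>\<close>.\<close>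

lemma gauss_moment_Suc:
  assumes B: "\<And>x. (B has_real_derivative B' x) (at x)" and B': "continuous_on UNIV B'"
    and bd: "\<And>x. \<bar>B x\<bar> \<le> 1" and bd': "\<And>x. \<bar>B' x\<bar> \<le> 1"
  shows "gauss_moment (Suc k) B t s
       = real k * gauss_moment (k - 1) B t s + s * gauss_moment k B' t s"
proof -
  have cB: "continuous_on UNIV B"
    using B by (meson DERIV_isCont continuous_at_imp_continuous_on)
  define F where "F z = std_normal_density z * z ^ k * B (t + s * z)" for z
  \<comment> \<open>This is the derivative of \<open>F\<close>. For \<open>k = 0\<close> the
    truncated exponent \<open>k - 1\<close> does no harm, since its coefficient
    \<open>real k\<close> vanishes.\<close>
  define f where "f z = real k * (std_normal_density z * z ^ (k - 1) * B (t + s * z))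
    + s * (std_normal_density z * z ^ k * B' (t + s * z))
    - std_normal_density z * z ^ Suc k * B (t + s * z)" for z
  have int: "integrable lborel f"
    unfolding f_def
    by (intro Bochner_Integration.integrable_diff Bochner_Integration.integrable_add
        integrable_mult_right integrable_gauss_moment cB B' bd bd')
  have dF: "(F has_real_derivative f z) (at z)" for z
  proof -
    have d\<phi>: "(std_normal_density has_real_derivative - z * std_normal_density z) (at z)"
    proof -
      have "((\<lambda>z. exp (- z\<^sup>2 / 2)) has_real_derivative - z * exp (- z\<^sup>2 / 2)) (at z)"
        by (auto intro!: derivative_eq_intros)
      from DERIV_cmult[OF this, of "1 / sqrt (2 * pi)"] show ?thesis
        unfolding std_normal_density_def by (simp add: ac_simps)
    qed
    have dB: "((\<lambda>z. B (t + s * z)) has_real_derivative B' (t + s * z) * s) (at z)"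
      by (rule DERIV_chain2[OF B]) (auto intro!: derivative_eq_intros)
    show ?thesis
      unfolding F_def f_def
      using DERIV_mult[OF DERIV_mult[OF d\<phi> DERIV_pow[of k]] dB]
      by (simp add: algebra_simps)
  qed
  have contf: "isCont f z" for z
  proof -
    have "continuous_on UNIV f"
      unfolding f_def normal_density_def
      by (intro continuous_intros continuous_on_compose2[OF cB] continuous_on_compose2[OF B']) auto
    then show ?thesis by (simp add: continuous_on_eq_continuous_at)
  qed
  have bdF: "norm (F z) \<le> std_normal_density z * \<bar>z\<bar> ^ k" for z
    using bd unfolding F_def by (auto simp: abs_mult power_abs intro!: mult_left_le)
  have top: "((\<lambda>z. std_normal_density z * \<bar>z\<bar> ^ k) \<longlongrightarrow> 0) at_top"
    unfolding std_normal_density_def by real_asymp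
  have bot: "((\<lambda>z. std_normal_density z * \<bar>z\<bar> ^ k) \<longlongrightarrow> 0) at_bot"
    unfolding std_normal_density_def by real_asymp
  have "(LBINT z=-\<infinity>..\<infinity>. f z) = 0 - 0"
  proof (rule interval_integral_FTC_integrable)
    show "(F has_vector_derivative f z) (at z)" for z
      using dF by (simp add: has_real_derivative_iff_has_vector_derivative)
    show "set_integrable lborel (einterval (-\<infinity>) \<infinity>) f"
      using int by (simp add: set_integrable_def)
    show "((F \<circ> real_of_ereal) \<longlongrightarrow> 0) (at_right (-\<infinity>))"
      unfolding ereal_tendsto_simps
      by (rule Lim_null_comparison[OF _ bot]) (use bdF in auto)
    show "((F \<circ> real_of_ereal) \<longlongrightarrow> 0) (at_left \<infinity>)"
      unfolding ereal_tendsto_simps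
      by (rule Lim_null_comparison[OF _ top]) (use bdF in auto)
  qed (use contf in auto)
  then have "(\<integral>z. f z \<partial>lborel) = 0"
    by (simp add: interval_lebesgue_integral_def set_lebesgue_integral_def)
  moreover have "(\<integral>z. f z \<partial>lborel) = real k * gauss_moment (k - 1) B t s
      + s * gauss_moment k B' t s - gauss_moment (Suc k) B t s"
  proof -
    note i = integrable_gauss_moment[OF cB bd] integrable_gauss_moment[OF B' bd']
    show ?thesis
      unfolding f_def gauss_moment_def
      by (simp only: Bochner_Integration.integral_diff Bochner_Integration.integral_add
          Bochner_Integration.integrable_add integrable_mult_right integral_mult_right_zero i)
  qed
  ultimately show ?thesis by simp
qed

lemma DERIV_gauss_avg_mean:
  assumes B: "\<And>x. (B has_real_derivative B' x) (at x)"
    and bd: "\<And>x. \<bar>B x\<bar> \<le> 1" and bd': "\<And>x. \<bar>B' x\<bar> \<le> 1"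
  shows "((\<lambda>t. gauss_avg B t s) has_real_derivative gauss_avg B' t s) (at t)"
  unfolding gauss_moment_def
proof (rule DERIV_lebesgue_integral[where w=std_normal_density])
  have cB: "continuous_on UNIV B"
    using B by (meson DERIV_isCont continuous_at_imp_continuous_on)
  show "integrable lborel (\<lambda>z. std_normal_density z * z ^ 0 * B (u + s * z))" for u
    by (rule integrable_gauss_moment[OF cB bd])
  show "((\<lambda>u. std_normal_density z * z ^ 0 * B (u + s * z)) has_real_derivative
      std_normal_density z * z ^ 0 * B' (u + s * z)) (at u)" for u z
  proof -
    have "((\<lambda>u. B (u + s * z)) has_real_derivative B' (u + s * z) * 1) (at u)"
      by (rule DERIV_chain2[OF B]) (auto intro!: derivative_eq_intros)
    from DERIV_cmult[OF this] show ?thesis by simp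
  qed
  show "\<bar>std_normal_density z * z ^ 0 * B' (u + s * z)\<bar> \<le> std_normal_density z" for u z
    using bd' by (auto simp: abs_mult intro!: mult_left_le)
qed simp

text \<open>Differentiating under the integral leaves a factor \<open>z\<close> next to
  \<open>B'\<close>; integration by parts trades it for \<open>s\<close> and one more derivative.
  This is the heat equation in the scale \<open>s\<close>.\<close>

lemma DERIV_gauss_avg_scale:
  assumes B: "\<And>x. (B has_real_derivative B' x) (at x)"
    and B': "\<And>x. (B' has_real_derivative B'' x) (at x)"  and B'': "continuous_on UNIV B''"
    and bd: "\<And>x. \<bar>B x\<bar> \<le> 1" "\<And>x. \<bar>B' x\<bar> \<le> 1" "\<And>x. \<bar>B'' x\<bar> \<le> 1"
  shows "((\<lambda>s. gauss_avg B t s) has_real_derivative s * gauss_avg B'' t s) (at s)"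
proof -
  have cB: "continuous_on UNIV B"
    using B by (meson DERIV_isCont continuous_at_imp_continuous_on)
  have "((\<lambda>s. gauss_avg B t s) has_real_derivative gauss_moment 1 B' t s) (at s)"
    unfolding gauss_moment_def
  proof (rule DERIV_lebesgue_integral[where w="\<lambda>z. std_normal_density z * \<bar>z\<bar> ^ 1"])
    show "integrable lborel (\<lambda>z. std_normal_density z * z ^ 0 * B (t + u * z))" for u
      by (rule integrable_gauss_moment[OF cB bd(1)])
    show "((\<lambda>u. std_normal_density z * z ^ 0 * B (t + u * z)) has_real_derivative
        std_normal_density z * z ^ 1 * B' (t + u * z)) (at u)" for u z
    proof -
      have "((\<lambda>u. B (t + u * z)) has_real_derivative B' (t + u * z) * z) (at u)"
        by (rule DERIV_chain2[OF B]) (auto intro!: derivative_eq_intros)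
      from DERIV_cmult[OF this, of "std_normal_density z"] show ?thesis
        by (simp add: ac_simps)
    qed
    show "\<bar>std_normal_density z * z ^ 1 * B' (t + u * z)\<bar> \<le> std_normal_density z * \<bar>z\<bar> ^ 1" for u z
      using bd(2) by (auto simp: abs_mult intro!: mult_left_le)
  qed (rule integrable_std_normal_moment_abs)
  then show ?thesis
    using gauss_moment_Suc[OF B' B'' bd(2,3), of 0 t s] by simp
qed

section \<open>Convexity of the logarithmic slope\<close>

declare One_nat_def [simp del]

section \<open>The logistic function and its first four derivatives\<close>

definition logistic :: "real \<Rightarrow> real" where
  "logistic x = exp x / (1 + exp x)"

text \<open>The \<open>k\<close>-th derivative of the logistic function for \<open>k \<le> 4\<close>, unspecified beyond.\<close>

definition logistic_D :: "nat \<Rightarrow> real \<Rightarrow> real" where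
  "logistic_D k x = (let p = logistic x; q = p * (1 - p)
     in [p, q, q * (1 - 2 * p), q * (1 - 6 * q), q * (1 - 2 * p) * (1 - 12 * q)] ! k)"

lemma logistic_bounds: "0 < logistic x" "logistic x < 1"
  by (auto simp: logistic_def field_simps add_pos_pos)

lemma logistic_minus: "logistic (- x) = 1 - logistic x"
proof -
  have "1 + exp x \<noteq> 0" "exp x \<noteq> 0" by (auto simp: add_pos_pos less_imp_neq[symmetric])
  then show ?thesis by (simp add: logistic_def exp_minus field_simps)
qed

lemma logistic_strict_mono: "x < y \<Longrightarrow> logistic x < logistic y"
  by (simp add: logistic_def divide_simps add_pos_pos algebra_simps)

lemma DERIV_logistic: "(logistic has_real_derivative logistic x * (1 - logistic x)) (at x)"
proof -
  have "1 + exp x \<noteq> 0" by (metis add_pos_pos exp_gt_zero less_irrefl zero_less_one)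
  then show ?thesis
    unfolding logistic_def[abs_def]
    by (auto intro!: derivative_eq_intros simp: divide_simps) (simp add: algebra_simps)
qed

lemma logistic_D_simps:
  "logistic_D 0 = logistic"
  "logistic_D 1 = (\<lambda>x. logistic x * (1 - logistic x))"
  by (simp_all add: logistic_D_def Let_def fun_eq_iff)

lemma DERIV_logistic_D:
  assumes "k < 4"
  shows "(logistic_D k has_real_derivative logistic_D (Suc k) x) (at x)"
proof -
  note [derivative_intros] = DERIV_logistic
  have "k = 0 \<or> k = 1 \<or> k = 2 \<or> k = 3" using assms by auto
  then show ?thesis
    unfolding logistic_D_def[abs_def] Let_def
    by (elim disjE; simp add: numeral_eq_Suc One_nat_def)
       (auto intro!: derivative_eq_intros simp: algebra_simps power2_eq_square)
qed

text \<open>The derivatives are polynomials in \<open>p\<close> and \<open>q = p * (1 - p)\<close>,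
  where \<open>p\<close> lies in (0, 1) and \<open>q\<close> in (0, 1/4]. The bound 1 is the one
  that the lemmas on Gaussian averages ask for.\<close>

lemma abs_logistic_D_le:
  assumes "k \<le> 4"
  shows "\<bar>logistic_D k x\<bar> \<le> 1"
proof -
  define p q where "p = logistic x" and "q = p * (1 - p)"
  have p: "0 < p" "p < 1" unfolding p_def by (rule logistic_bounds)+
  have "0 \<le> (p - 1/2)\<^sup>2" by simp
  then have q: "0 < q" "q \<le> 1 / 4"
    using p unfolding q_def by (auto simp: power2_eq_square algebra_simps)
  have 1: "\<bar>1 - 2 * p\<bar> \<le> 1" "\<bar>1 - 6 * q\<bar> \<le> 1" "\<bar>1 - 12 * q\<bar> \<le> 2"
    using p q by auto
  have 2: "\<bar>q * (1 - 2 * p)\<bar> \<le> (1 / 4) * 1" "\<bar>q * (1 - 6 * q)\<bar> \<le> (1 / 4) * 1"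
    unfolding abs_mult using 1 q by (intro mult_mono; simp)+
  have 3: "\<bar>q * (1 - 2 * p) * (1 - 12 * q)\<bar> \<le> (1 / 4 * 1) * 2"
    unfolding abs_mult[of "q * (1 - 2 * p)"] using 1 2 by (intro mult_mono) simp_all
  have "k = 0 \<or> k = 1 \<or> k = 2 \<or> k = 3 \<or> k = 4" using assms by auto
  then show ?thesis
    unfolding logistic_D_def Let_def p_def[symmetric] q_def[symmetric]
    using p q 2 3 by (elim disjE; simp add: numeral_eq_Suc One_nat_def)
qed

lemma continuous_logistic_D:
  assumes "k \<le> 4"
  shows "continuous_on UNIV (logistic_D k)"
proof -
  have [continuous_intros]: "continuous_on UNIV logistic"
    by (meson DERIV_isCont DERIV_logistic continuous_at_imp_continuous_on)
  have "k = 0 \<or> k = 1 \<or> k = 2 \<or> k = 3 \<or> k = 4" using assms by auto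
  then show ?thesis
    unfolding logistic_D_def[abs_def] Let_def
    by (elim disjE; simp add: numeral_eq_Suc One_nat_def) (auto intro!: continuous_intros)
qed

lemma logistic_D_1_pos: "0 < logistic_D 1 x"
  using logistic_bounds[of x] by (simp add: logistic_D_simps)

lemma logistic_D_1_minus: "logistic_D 1 (- x) = logistic_D 1 x"
  by (simp add: logistic_D_simps logistic_minus)

lemma logistic_D_1_less:
  assumes "\<bar>a\<bar> < b"
  shows "logistic_D 1 b < logistic_D 1 a"
proof -
  have "logistic a < logistic b" "logistic (- a) < logistic b"
    using assms by (auto intro!: logistic_strict_mono)
  \<comment> \<open>This product is the difference \<open>logistic_D 1 a - logistic_D 1 b\<close> in
    factored form; its second factor is \<open>logistic b - logistic (- a)\<close>.\<close>
  then have "0 < (logistic b - logistic a) * (logistic b + logistic a - 1)"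
    by (simp add: logistic_minus)
  then show ?thesis by (simp add: logistic_D_simps algebra_simps)
qed

section \<open>Moments of the Gaussian density tilted by the logistic derivative\<close>

abbreviation logistic_avg :: "nat \<Rightarrow> real \<Rightarrow> real \<Rightarrow> real" where
  "logistic_avg k \<equiv> gauss_avg (logistic_D k)"

lemma integrable_logistic_moment:
  "j \<le> 4 \<Longrightarrow> integrable lborel (\<lambda>z. std_normal_density z * z ^ k * logistic_D j (t + s * z))"
  by (intro integrable_gauss_moment continuous_logistic_D abs_logistic_D_le)

text \<open>A zero integral would make \<open>F\<close> vanish almost everywhere, hence put almost
  every real into the finite null set \<open>S\<close>. The set \<open>S\<close> takes in the centre
  of reflection and the sign changes of the integrands below.\<close>

lemma integral_pos_off_finite:
  fixes F :: "real \<Rightarrow> real"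
  assumes F: "integrable lborel F" and S: "finite S"
    and nonneg: "\<And>x. 0 \<le> F x" and pos: "\<And>x. x \<notin> S \<Longrightarrow> 0 < F x"
  shows "0 < (\<integral>x. F x \<partial>lborel)"
proof (rule ccontr)
  assume "\<not> ?thesis"
  moreover have "0 \<le> (\<integral>x. F x \<partial>lborel)" using nonneg by simp
  ultimately have "(\<integral>x. F x \<partial>lborel) = 0" by simp
  then have "AE x in lborel. F x = 0"
    using integral_nonneg_eq_0_iff_AE[OF F] nonneg by simp
  then have "AE x in lborel. x \<in> S"
    by eventually_elim (use pos in force)
  then have "emeasure lborel (UNIV :: real set) \<le> emeasure lborel S"
    by (intro emeasure_mono_AE) (auto simp: S finite_imp_closed intro: borel_closed)
  then show False
    using S by (simp add: emeasure_lborel_UNIV emeasure_lborel_countable countable_finite)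
qed

lemma logistic_avg_1_pos: "0 < logistic_avg 1 t s"
  unfolding gauss_moment_def
  using integrable_logistic_moment[of 1 0 t s]
  by (intro integral_pos_off_finite[where S="{}"])
     (auto intro!: mult_nonneg_nonneg mult_pos_pos logistic_D_1_pos less_imp_le normal_density_pos)

text \<open>The slope \<open>d'\<close> increases strictly on the positive reals. A nonnegative
  value between the zeros would require a nonnegative slope followed by a nonpositive one; beyond
  \<open>r0\<close> the slope exceeds the zero slope found between the zeros.\<close>

lemma strictly_convex_sign_change:
  fixes d d' d'' :: "real \<Rightarrow> real"
  assumes d: "\<And>r. (d has_real_derivative d' r) (at r)"
    and d': "\<And>r. (d' has_real_derivative d'' r) (at r)"
    and pos: "\<And>r. 0 < r \<Longrightarrow> 0 < d'' r"
    and zero: "d 0 = 0" "d r0 = 0" "0 < r0"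
  shows "0 < r \<Longrightarrow> r < r0 \<Longrightarrow> d r < 0" and "r0 < r \<Longrightarrow> 0 < d r"
proof -
  have mono: "d' x < d' y" if "0 < x" "x < y" for x y
    using that pos d' by (intro DERIV_pos_imp_increasing[OF that(2)]) force
  {
    assume r: "0 < r" "r < r0"
    obtain x where x: "0 < x" "x < r" "d r - d 0 = (r - 0) * d' x"
      using MVT2[OF r(1)] d by blast
    obtain y where y: "r < y" "y < r0" "d r0 - d r = (r0 - r) * d' y"
      using MVT2[OF r(2)] d by blast
    show "d r < 0"
    proof (rule ccontr)
      assume "\<not> d r < 0"
      then have "0 \<le> r * d' x" "(r0 - r) * d' y \<le> 0"
        using x(3) y(3) zero by simp_all
      then have "0 \<le> d' x" "d' y \<le> 0"
        using r by (simp_all add: zero_le_mult_iff mult_le_0_iff)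
      with mono[of x y] x y show False by linarith
    qed
  }
  {
    assume r: "r0 < r"
    obtain x where x: "0 < x" "x < r0" "d r0 - d 0 = (r0 - 0) * d' x"
      using MVT2[OF zero(3)] d by blast
    obtain y where y: "r0 < y" "y < r" "d r - d r0 = (r - r0) * d' y"
      using MVT2[OF r] d by blast
    have "d' x = 0" using x zero by simp
    then have "0 < d' y" using mono[of x y] x(1,2) y(1,2) by linarith
    then have "0 < (r - r0) * d' y" using r by simp
    then show "0 < d r" using y(3) zero by simp
  }
qed

text \<open>The sum of the substitutions \<open>x = c + r\<close> and \<open>x = c - r\<close>. It
  turns odd moments about \<open>c\<close> into integrals of the difference of a density at mirrored
  points.\<close>

lemma integral_symmetrize:
  fixes F :: "real \<Rightarrow> real"
  assumes F: "integrable lborel F"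
  shows "2 * (\<integral>x. F x \<partial>lborel) = (\<integral>r. F (c + r) + F (c - r) \<partial>lborel)"
    and "integrable lborel (\<lambda>r. F (c + r) + F (c - r))"
proof -
  have 1: "integrable lborel (\<lambda>r. F (c + r))" "integrable lborel (\<lambda>r. F (c - r))"
    using lborel_integrable_real_affine[OF F, of 1 c] lborel_integrable_real_affine[OF F, of "-1" c]
    by simp_all
  show "integrable lborel (\<lambda>r. F (c + r) + F (c - r))" using 1 by simp
  have "(\<integral>x. F x \<partial>lborel) = (\<integral>r. F (c + r) \<partial>lborel)" "(\<integral>x. F x \<partial>lborel) = (\<integral>r. F (c - r) \<partial>lborel)"
    using lborel_integral_real_affine[of 1 F c] lborel_integral_real_affine[of "-1" F c] by simp_all
  then show "2 * (\<integral>x. F x \<partial>lborel) = (\<integral>r. F (c + r) + F (c - r) \<partial>lborel)"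
    using 1 by simp
qed

text \<open>The expression is the integral of \<open>t + s * z\<close> against the tilted density.
  Under reflection about the zero \<open>- t / s\<close> of this factor the logistic derivative is
  even, while the normal density is larger at the mirror point nearer to 0, which is the one where
  the factor is positive.\<close>

lemma tilted_mean_pos:
  assumes "0 < t" "0 < s"
  shows "0 < t * logistic_avg 1 t s + s * gauss_moment 1 (logistic_D 1) t s"
proof -
  define F where "F z = t * (std_normal_density z * z ^ 0 * logistic_D 1 (t + s * z))
    + s * (std_normal_density z * z ^ 1 * logistic_D 1 (t + s * z))" for z
  have F: "integrable lborel F"
    unfolding F_def by (intro Bochner_Integration.integrable_add integrable_mult_right
        integrable_logistic_moment) auto
  have F_eq: "F (- t / s + r) + F (- t / s - r) = s * r * logistic_D 1 (s * r) *
      (std_normal_density (- t / s + r) - std_normal_density (- t / s - r))" for r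
  proof -
    have *: "t + s * (- t / s + r) = s * r" "t + s * (- t / s - r) = - (s * r)"
      using assms by (simp_all add: field_simps)
    have "F z = (t + s * z) * (std_normal_density z * logistic_D 1 (t + s * z))" for z
      by (simp add: F_def algebra_simps)
    then show ?thesis
      by (simp only: * logistic_D_1_minus) (simp add: algebra_simps)
  qed
  have *: "0 < r * (std_normal_density (- t / s + r) - std_normal_density (- t / s - r))"
    if "r \<noteq> 0" for r
  proof -
    have sq: "(- t / s - r)\<^sup>2 - (- t / s + r)\<^sup>2 = 4 * (t / s) * r"
      by (simp add: power2_eq_square algebra_simps)
    consider "0 < r" | "r < 0" using \<open>r \<noteq> 0\<close> by linarith
    then show ?thesis
    proof cases
      case 1
      then have "0 < 4 * (t / s) * r" using assms by simp
      then have "std_normal_density (- t / s - r) < std_normal_density (- t / s + r)"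
        unfolding std_normal_density_def using sq
        by (intro mult_strict_left_mono) auto
      then show ?thesis using 1 by simp
    next
      case 2
      then have "4 * (t / s) * r < 0" using assms by (intro mult_pos_neg) auto
      then have "std_normal_density (- t / s + r) < std_normal_density (- t / s - r)"
        unfolding std_normal_density_def using sq
        by (intro mult_strict_left_mono) auto
      then show ?thesis using 2 by (simp add: mult_neg_neg)
    qed
  qed
  have "0 < (\<integral>r. F (- t / s + r) + F (- t / s - r) \<partial>lborel)"
  proof (rule integral_pos_off_finite[where S="{0}"])
    have pos: "0 < F (- t / s + r) + F (- t / s - r)" if "r \<noteq> 0" for r
      unfolding F_eq using mult_pos_pos[OF mult_pos_pos[OF assms(2) logistic_D_1_pos] *[OF that]]
      by (simp add: ac_simps)
    then show "0 < F (- t / s + r) + F (- t / s - r)" if "r \<notin> {0}" for r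
      using that by simp
    show "0 \<le> F (- t / s + r) + F (- t / s - r)" for r
      using pos[of r] F_eq[of r] by (cases "r = 0") auto
    show "integrable lborel (\<lambda>r. F (- t / s + r) + F (- t / s - r))"
      by (rule integral_symmetrize(2)[OF F])
  qed simp
  then have "0 < (\<integral>z. F z \<partial>lborel)"
    using integral_symmetrize(1)[OF F, of "- t / s"] by linarith
  then show ?thesis
    unfolding F_def gauss_moment_def
    by (simp only: Bochner_Integration.integral_add integrable_mult_right integral_mult_right_zero
        integrable_logistic_moment one_le_numeral)
qed

text \<open>Normalising \<open>p\<close> would only divide the integrals by a positive constant, so
  \<open>mean\<close> says that \<open>m\<close> is the mean and the conclusion concerns the third
  central moment.\<close>

lemma third_central_moment_pos:
  fixes t s :: real
  assumes ts: "0 < t" "0 < s"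
  defines "p \<equiv> \<lambda>z. std_normal_density z * logistic_D 1 (t + s * z)"
  assumes m: "0 < t + s * m" and i1: "integrable lborel (\<lambda>z. (z - m) * p z)"
    and i3: "integrable lborel (\<lambda>z. (z - m) ^ 3 * p z)"
    and mean: "(\<integral>z. (z - m) * p z \<partial>lborel) = 0"
  shows "0 < (\<integral>z. (z - m) ^ 3 * p z \<partial>lborel)"
proof -
  define \<mu> where "\<mu> = t + s * m"
  have \<mu>: "0 < \<mu>" using m by (simp add: \<mu>_def)
  define H where "H r = p (m + r) - p (m - r)" for r
  have p_pos: "0 < p z" for z
    unfolding p_def by (intro mult_pos_pos normal_density_pos logistic_D_1_pos) simp
  have H0: "H 0 = 0" and H_minus: "H (- r) = - H r" for r
    by (simp_all add: H_def)
  have contH: "continuous_on UNIV H"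
    unfolding H_def p_def normal_density_def
    by (intro continuous_intros continuous_on_compose2[OF continuous_logistic_D[of 1]]) auto
  have mean': "(\<integral>r. r * H r \<partial>lborel) = 0" and i1': "integrable lborel (\<lambda>r. r * H r)"
    using integral_symmetrize[OF i1, of m] mean by (simp_all add: H_def algebra_simps)
  have third: "2 * (\<integral>z. (z - m) ^ 3 * p z \<partial>lborel) = (\<integral>r. r ^ 3 * H r \<partial>lborel)"
    and i3': "integrable lborel (\<lambda>r. r ^ 3 * H r)"
    using integral_symmetrize[OF i3, of m] by (simp_all add: H_def algebra_simps)

  \<comment> \<open>The logarithm of \<open>p (m + r) / p (m - r)\<close>: the Gaussian factors
    contribute exactly \<open>- 2 * m * r\<close>. It has the same sign as
    \<open>H r\<close>.\<close>
  define d where "d r = ln (logistic_D 1 (\<mu> + s * r)) - ln (logistic_D 1 (\<mu> - s * r)) - 2 * m * r" for r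
  define d' where "d' r = s * (1 - 2 * logistic (\<mu> + s * r)) + s * (1 - 2 * logistic (\<mu> - s * r)) - 2 * m" for r
  define d'' where "d'' r = 2 * s\<^sup>2 * (logistic_D 1 (\<mu> - s * r) - logistic_D 1 (\<mu> + s * r))" for r
  have dln: "((\<lambda>x. ln (logistic_D 1 x)) has_real_derivative 1 - 2 * logistic x) (at x)" for x
  proof -
    have "((\<lambda>x. ln (logistic_D 1 x)) has_real_derivative
        inverse (logistic_D 1 x) * logistic_D (Suc 1) x) (at x)"
      by (intro DERIV_chain2[OF DERIV_ln] DERIV_logistic_D logistic_D_1_pos) simp
    moreover have "inverse (logistic_D 1 x) * logistic_D (Suc 1) x = 1 - 2 * logistic x"
      using logistic_bounds[of x] by (simp add: logistic_D_def Let_def One_nat_def field_simps)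
    ultimately show ?thesis by simp
  qed
  have lin: "((\<lambda>r. \<mu> + s * r) has_real_derivative s) (at r)"
    "((\<lambda>r. \<mu> - s * r) has_real_derivative - s) (at r)" for r
    by (auto intro!: derivative_eq_intros)
  have dd: "(d has_real_derivative d' r) (at r)" for r
    unfolding d_def d'_def
    by (rule DERIV_cong[OF DERIV_diff[OF DERIV_diff[OF DERIV_chain2[OF dln lin(1)]
          DERIV_chain2[OF dln lin(2)]] DERIV_cmult_Id]]) (simp add: algebra_simps)
  have dd': "(d' has_real_derivative d'' r) (at r)" for r
  proof -
    have *: "((\<lambda>r. logistic (\<mu> + s * r)) has_real_derivative logistic_D 1 (\<mu> + s * r) * s) (at r)"
      "((\<lambda>r. logistic (\<mu> - s * r)) has_real_derivative logistic_D 1 (\<mu> - s * r) * - s) (at r)"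
      using DERIV_chain2[OF DERIV_logistic lin(1)] DERIV_chain2[OF DERIV_logistic lin(2)]
      by (simp_all add: logistic_D_simps)
    show ?thesis
      unfolding d'_def d''_def
      by (rule derivative_eq_intros * refl)+ (simp add: algebra_simps power2_eq_square)
  qed
  \<comment> \<open>Positivity of the logistic argument at the mean enters here: it places
    \<open>\<mu> - s * r\<close> nearer to 0 than \<open>\<mu> + s * r\<close>.\<close>
  have d''_pos: "0 < d'' r" if "0 < r" for r
  proof -
    have "0 < s * r" using that ts by simp
    then have "\<bar>\<mu> - s * r\<bar> < \<mu> + s * r" using \<mu> by linarith
    then show ?thesis using ts logistic_D_1_less by (simp add: d''_def)
  qed
  have dH: "sgn (d r) = sgn (H r)" for r
  proof -
    have ln_p: "ln (p z) = ln (1 / sqrt (2 * pi)) - z\<^sup>2 / 2 + ln (logistic_D 1 (t + s * z))" for z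
      unfolding p_def std_normal_density_def using logistic_D_1_pos[of "t + s * z"]
      by (simp add: ln_mult ln_div)
    then have "d r = ln (p (m + r)) - ln (p (m - r))"
      unfolding d_def \<mu>_def ln_p by (simp add: power2_eq_square field_simps)
    then show ?thesis
      using p_pos[of "m + r"] p_pos[of "m - r"] ln_less_cancel_iff[of "p (m + r)" "p (m - r)"]
        ln_less_cancel_iff[of "p (m - r)" "p (m + r)"]
      by (simp add: H_def sgn_if)
  qed

  \<comment> \<open>Without a zero, \<open>H\<close> keeps the sign of \<open>H 1\<close> on the
    positive reals, so \<open>r * H r * H 1\<close> is positive off 0. Its integral would be
    positive, against the mean equation.\<close>
  have "\<exists>r0>0. H r0 = 0"
  proof (rule ccontr)
    assume no: "\<not> ?thesis"
    have same: "0 < H x * H 1" if "0 < x" for x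
    proof (rule ccontr)
      assume "\<not> 0 < H x * H 1"
      then have "(H x \<le> 0 \<and> 0 \<le> H 1) \<or> (H 1 \<le> 0 \<and> 0 \<le> H x)"
        by (auto simp: zero_less_mult_iff not_less)
      then have "\<exists>y. min x 1 \<le> y \<and> y \<le> max x 1 \<and> H y = 0"
        using IVT'[of H x 0 1] IVT'[of H 1 0 x] IVT2'[of H x 0 1] IVT2'[of H 1 0 x]
          continuous_on_subset[OF contH] by (cases "x \<le> 1") (auto simp: min_def max_def)
      then show False using no that by (auto simp: min_def split: if_splits)
    qed
    have pos: "0 < r * H r * H 1" if "r \<noteq> 0" for r
    proof (cases "0 < r")
      case True
      then show ?thesis using same[of r] mult_pos_pos[of r "H r * H 1"] by (simp add: ac_simps)
    next
      case False
      then show ?thesis using that same[of "- r"] mult_pos_pos[of "- r" "H (- r) * H 1"]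
        by (simp add: H_minus ac_simps)
    qed
    have "0 < (\<integral>r. r * H r * H 1 \<partial>lborel)"
    proof (rule integral_pos_off_finite[where S="{0}"])
      show "0 \<le> r * H r * H 1" for r
        using pos[of r] by (cases "r = 0") auto
    qed (use pos i1' in auto)
    then show False using mean' by simp
  qed
  then obtain r0 where r0: "0 < r0" "H r0 = 0" by blast
  then have "d r0 = 0" "d 0 = 0" using dH[of r0] by (simp_all add: sgn_if d_def split: if_splits)
  note sign = strictly_convex_sign_change[OF dd dd' d''_pos \<open>d 0 = 0\<close> \<open>d r0 = 0\<close> r0(1)]
  have pos: "0 < (r\<^sup>2 - r0\<^sup>2) * (r * H r)" if "0 < r" "r \<noteq> r0" for r
  proof (cases "r < r0")
    case True
    then have "H r < 0" using sign(1)[of r] dH[of r] that by (simp add: sgn_if split: if_splits)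
    moreover have "r\<^sup>2 < r0\<^sup>2" using True that by (intro power_strict_mono) auto
    ultimately show ?thesis using that by (intro mult_neg_neg) (auto simp: mult_pos_neg)
  next
    case False
    then have "0 < H r" using sign(2)[of r] dH[of r] that by (simp add: sgn_if split: if_splits)
    moreover have "r0\<^sup>2 < r\<^sup>2" using False that r0 by (intro power_strict_mono) auto
    ultimately show ?thesis using that by simp
  qed
  have pos': "0 < (r\<^sup>2 - r0\<^sup>2) * (r * H r)" if "r \<notin> {0, r0, - r0}" for r
    using pos[of r] pos[of "- r"] that by (cases "0 < r") (auto simp: H_minus)
  \<comment> \<open>Subtracting \<open>r0\<^sup>2\<close> times the vanishing first moment leaves
    the third moment unchanged and makes the integrand nonnegative.\<close>
  have "0 < (\<integral>r. (r\<^sup>2 - r0\<^sup>2) * (r * H r) \<partial>lborel)"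
  proof (rule integral_pos_off_finite[where S="{0, r0, - r0}"])
    have eq: "(r\<^sup>2 - r0\<^sup>2) * (r * H r) = r ^ 3 * H r - r0\<^sup>2 * (r * H r)" for r
      by (simp add: power3_eq_cube power2_eq_square algebra_simps)
    show "integrable lborel (\<lambda>r. (r\<^sup>2 - r0\<^sup>2) * (r * H r))"
      unfolding eq using i1' i3' by simp
    show "0 \<le> (r\<^sup>2 - r0\<^sup>2) * (r * H r)" for r
      using pos'[of r] by (cases "r \<in> {0, r0, - r0}") auto
  qed (use pos' in auto)
  also have "\<dots> = (\<integral>r. r ^ 3 * H r - r0\<^sup>2 * (r * H r) \<partial>lborel)"
    by (rule Bochner_Integration.integral_cong)
      (simp_all add: power3_eq_cube power2_eq_square algebra_simps)
  also have "\<dots> = (\<integral>r. r ^ 3 * H r \<partial>lborel)"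
    using i1' i3' mean' by simp
  finally show ?thesis using third by linarith
qed

text \<open>Repeated integration by parts replaces powers of \<open>z\<close> by derivatives of the
  logistic function.\<close>

lemma logistic_moments:
  fixes t s :: real
  defines "g \<equiv> \<lambda>k. gauss_moment k (logistic_D 1) t s" and "A \<equiv> \<lambda>k. logistic_avg k t s"
  shows "g 1 = s * A 2" and "g 2 = A 1 + s\<^sup>2 * A 3" and "g 3 = 3 * s * A 2 + s ^ 3 * A 4"
proof -
  have suc: "gauss_moment (Suc k) (logistic_D j) t s
      = real k * gauss_moment (k - 1) (logistic_D j) t s + s * gauss_moment k (logistic_D (Suc j)) t s"
    if "j < 4" for j k
    using that
    by (intro gauss_moment_Suc DERIV_logistic_D continuous_logistic_D abs_logistic_D_le) auto
  show "g 1 = s * A 2" "g 2 = A 1 + s\<^sup>2 * A 3" "g 3 = 3 * s * A 2 + s ^ 3 * A 4"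
    unfolding g_def A_def
    by (simp_all add: numeral_eq_Suc One_nat_def suc power2_eq_square algebra_simps)
qed

text \<open>The function \<open>G\<close> of the opening comment, that is, the derivative of
  \<open>ln (logistic_avg 1 t s)\<close> in \<open>t\<close>. The scale comes first so that
  \<open>log_slope s\<close> is a function of \<open>t\<close> alone.\<close>

definition log_slope :: "real \<Rightarrow> real \<Rightarrow> real" where
  "log_slope s t = logistic_avg 2 t s / logistic_avg 1 t s"

text \<open>Up to positive factors the expression is both the third central moment of the tilted
  density and the second derivative of \<open>log_slope s\<close> at \<open>t\<close>.\<close>

lemma log_slope_curvature_pos:
  fixes t s :: real
  assumes ts: "0 < t" "0 < s"
  defines "A \<equiv> \<lambda>k. logistic_avg k t s"
  shows "0 < A 4 * (A 1)\<^sup>2 - 3 * A 1 * A 2 * A 3 + 2 * A 2 ^ 3"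
proof -
  define p where "p = (\<lambda>z. std_normal_density z * logistic_D 1 (t + s * z))"
  define g where "g k = gauss_moment k (logistic_D 1) t s" for k
  have gi: "integrable lborel (\<lambda>z. z ^ k * p z)" for k
    using integrable_logistic_moment[of 1 k t s] by (simp add: p_def ac_simps)
  have g: "g k = (\<integral>z. z ^ k * p z \<partial>lborel)" for k
    unfolding g_def gauss_moment_def p_def by (simp add: ac_simps)
  have g0: "g 0 = A 1" by (simp add: g_def A_def)
  have A1: "0 < A 1" unfolding A_def by (rule logistic_avg_1_pos)
  have mom: "g 1 = s * A 2" "g 2 = A 1 + s\<^sup>2 * A 3" "g 3 = 3 * s * A 2 + s ^ 3 * A 4"
    using logistic_moments[of t s] by (simp_all add: A_def g_def)
  \<comment> \<open>The mean \<open>g 1 / g 0\<close> of the tilted density.\<close>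
  define m where "m = s * A 2 / A 1"
  have "0 < t * A 1 + s * g 1"
    using tilted_mean_pos[OF ts] by (simp add: A_def g_def)
  also have "\<dots> = (t + s * m) * A 1" using A1 by (simp add: m_def mom field_simps)
  finally have m_pos: "0 < t + s * m" using A1 by (simp add: zero_less_mult_iff)
  have e1: "(z - m) * p z = z ^ 1 * p z - m * (z ^ 0 * p z)" for z
    by (simp add: algebra_simps)
  have e3: "(z - m) ^ 3 * p z = z ^ 3 * p z - 3 * m * (z ^ 2 * p z) + 3 * m\<^sup>2 * (z ^ 1 * p z)
      - m ^ 3 * (z ^ 0 * p z)" for z
    by (simp add: power3_eq_cube power2_eq_square algebra_simps)
  note int = Bochner_Integration.integral_diff Bochner_Integration.integral_add
    Bochner_Integration.integrable_diff Bochner_Integration.integrable_add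
    integrable_mult_right integral_mult_right_zero gi
  have i1: "integrable lborel (\<lambda>z. (z - m) * p z)"
    unfolding e1 by (simp only: int)
  have i3: "integrable lborel (\<lambda>z. (z - m) ^ 3 * p z)"
    unfolding e3 by (simp only: int)
  have mean: "(\<integral>z. (z - m) * p z \<partial>lborel) = 0"
    unfolding e1 by (simp only: int g[symmetric]) (use A1 in \<open>simp add: g0 mom m_def\<close>)
  have "0 < (\<integral>z. (z - m) ^ 3 * p z \<partial>lborel)"
    using third_central_moment_pos[OF ts m_pos i1[unfolded p_def] i3[unfolded p_def]
        mean[unfolded p_def]] unfolding p_def .
  also have "\<dots> = g 3 - 3 * m * g 2 + 3 * m\<^sup>2 * g 1 - m ^ 3 * g 0"
    unfolding e3 by (simp only: int g[symmetric])
  also have "\<dots> = s ^ 3 * (A 4 * (A 1)\<^sup>2 - 3 * A 1 * A 2 * A 3 + 2 * A 2 ^ 3) / (A 1)\<^sup>2"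
    using A1 by (simp add: g0 mom m_def field_simps power2_eq_square power3_eq_cube)
  finally show ?thesis
    using A1 ts by (simp add: zero_less_divide_iff zero_less_mult_iff)
qed

lemma DERIV_logistic_avg:
  "k < 4 \<Longrightarrow> ((\<lambda>t. logistic_avg k t s) has_real_derivative logistic_avg (Suc k) t s) (at t)"
  by (intro DERIV_gauss_avg_mean DERIV_logistic_D abs_logistic_D_le) auto

text \<open>The curvature is known to be positive only for positive arguments. The left end may
  still be 0, because the mean value theorem supplies interior points.\<close>

lemma log_slope_strictly_convex:
  assumes s: "0 < s" and q: "0 \<le> x" "x < y" "y < z"
  shows "(log_slope s y - log_slope s x) / (y - x) < (log_slope s z - log_slope s y) / (z - y)"
proof -
  define A where "A k t = logistic_avg k t s" for k t
  define G' where "G' t = A 3 t / A 1 t - (A 2 t / A 1 t)\<^sup>2" for t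
  define G'' where "G'' t = (A 4 t * A 1 t - A 3 t * A 2 t) / (A 1 t * A 1 t)
    - 2 * (A 2 t / A 1 t) * ((A 3 t * A 1 t - A 2 t * A 2 t) / (A 1 t * A 1 t))" for t
  have A1: "0 < A 1 t" for t unfolding A_def by (rule logistic_avg_1_pos)
  have dA: "(A 1 has_real_derivative A 2 t) (at t)" "(A 2 has_real_derivative A 3 t) (at t)"
    "(A 3 has_real_derivative A 4 t) (at t)" for t
    using DERIV_logistic_avg[of 1 s t] DERIV_logistic_avg[of 2 s t] DERIV_logistic_avg[of 3 s t]
    by (simp_all add: A_def[abs_def] numeral_eq_Suc One_nat_def)
  have dA21: "((\<lambda>t. A 2 t / A 1 t) has_real_derivative
      (A 3 t * A 1 t - A 2 t * A 2 t) / (A 1 t * A 1 t)) (at t)" for t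
    using A1[of t] by (intro DERIV_divide dA) simp
  have dG: "(log_slope s has_real_derivative G' t) (at t)" for t
  proof -
    have "log_slope s = (\<lambda>t. A 2 t / A 1 t)" by (simp add: fun_eq_iff log_slope_def A_def)
    moreover have "G' t = (A 3 t * A 1 t - A 2 t * A 2 t) / (A 1 t * A 1 t)"
      unfolding G'_def using A1[of t] by (simp add: divide_simps power2_eq_square)
    ultimately show ?thesis using dA21[of t] by simp
  qed
  have dG': "(G' has_real_derivative G'' t) (at t)" for t
  proof -
    have d3: "((\<lambda>t. A 3 t / A 1 t) has_real_derivative
        (A 4 t * A 1 t - A 3 t * A 2 t) / (A 1 t * A 1 t)) (at t)"
      using A1[of t] by (intro DERIV_divide dA) simp
    have d2: "((\<lambda>t. (A 2 t / A 1 t)\<^sup>2) has_real_derivative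
        2 * (A 2 t / A 1 t) * ((A 3 t * A 1 t - A 2 t * A 2 t) / (A 1 t * A 1 t))) (at t)"
    proof -
      have "x * y + x * y = 2 * y * x" for x y :: real by simp
      then show ?thesis
        unfolding power2_eq_square by (rule DERIV_cong[OF DERIV_mult[OF dA21 dA21]])
    qed
    show ?thesis
      unfolding G'_def[abs_def] G''_def by (rule DERIV_diff[OF d3 d2])
  qed
  have G''_pos: "0 < G'' t" if "0 < t" for t
  proof -
    have "G'' t = (A 4 t * (A 1 t)\<^sup>2 - 3 * A 1 t * A 2 t * A 3 t + 2 * A 2 t ^ 3) / (A 1 t) ^ 3"
      unfolding G''_def using A1[of t]
      by (simp add: divide_simps) (simp add: algebra_simps power2_eq_square power3_eq_cube)
    then show ?thesis
      using log_slope_curvature_pos[OF that s] A1[of t] unfolding A_def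
      by (simp only: divide_pos_pos zero_less_power)
  qed
  obtain u where u: "x < u" "u < y" "log_slope s y - log_slope s x = (y - x) * G' u"
    using MVT2[OF q(2), of "log_slope s" G'] dG by blast
  obtain v where v: "y < v" "v < z" "log_slope s z - log_slope s y = (z - y) * G' v"
    using MVT2[OF q(3), of "log_slope s" G'] dG by blast
  have "G' u < G' v"
  proof (rule DERIV_pos_imp_increasing[of u v G'])
    show "u < v" using u v by linarith
    fix w assume "u \<le> w"
    then have "0 < w" using u q by linarith
    then show "\<exists>D. (G' has_real_derivative D) (at w) \<and> 0 < D"
      using dG'[of w] G''_pos[of w] by (intro exI conjI)
  qed
  moreover have "y - x \<noteq> 0" "z - y \<noteq> 0" using q by simp_all
  ultimately show ?thesis unfolding u(3) v(3) by simp
qed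

section \<open>Level curves\<close>

lemma tendsto_logistic_avg:
  assumes k: "k \<le> 4" and f: "(f \<longlongrightarrow> a) F" and g: "(g \<longlongrightarrow> b) F"
  shows "((\<lambda>x. logistic_avg k (f x) (g x)) \<longlongrightarrow> logistic_avg k a b) F"
proof -
  have "continuous_on UNIV (\<lambda>p. logistic_avg k (fst p) (snd p))"
    using k by (intro continuous_on_gauss_avg continuous_logistic_D abs_logistic_D_le)
  from continuous_on_tendsto_compose[OF this tendsto_Pair[OF f g]] show ?thesis by simp
qed

section \<open>Monotonicity, symmetry and quantiles of the averaged logistic function\<close>

lemma logistic_avg_0_mono_iff: "logistic_avg 0 t s < logistic_avg 0 t' s \<longleftrightarrow> t < t'"
proof -
  have mono: "logistic_avg 0 t s < logistic_avg 0 t' s" if "t < t'" for t t'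
    using DERIV_pos_imp_increasing[OF that, of "\<lambda>t. logistic_avg 0 t s"]
      DERIV_logistic_avg[of 0 s] logistic_avg_1_pos[of _ s]
    by (fastforce simp: One_nat_def)
  then show ?thesis by (metis less_asym linorder_neqE_linordered_idom)
qed

lemma logistic_avg_0_eq_iff: "logistic_avg 0 t s = logistic_avg 0 t' s \<longleftrightarrow> t = t'"
  using logistic_avg_0_mono_iff[of t s t'] logistic_avg_0_mono_iff[of t' s t] by fastforce

lemma logistic_avg_0_minus: "logistic_avg 0 (- t) s = 1 - logistic_avg 0 t s"
proof -
  let ?f = "\<lambda>z. std_normal_density z * logistic_D 0 (- t + s * z)"
  have "logistic_avg 0 (- t) s = (\<integral>z. ?f (0 + - 1 * z) \<partial>lborel)"
    using lborel_integral_real_affine[of "- 1" ?f 0] by (simp add: gauss_moment_def)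
  also have "\<dots> = (\<integral>z. std_normal_density z - std_normal_density z * z ^ 0 * logistic_D 0 (t + s * z) \<partial>lborel)"
  proof (rule Bochner_Integration.integral_cong)
    fix z
    have "logistic (- t - s * z) = 1 - logistic (t + s * z)"
      using logistic_minus[of "t + s * z"] by simp
    then show "?f (0 + - 1 * z) = std_normal_density z - std_normal_density z * z ^ 0 * logistic_D 0 (t + s * z)"
      by (simp add: logistic_D_simps std_normal_density_def right_diff_distrib diff_divide_distrib)
  qed simp
  also have "\<dots> = 1 - logistic_avg 0 t s"
    using integrable_logistic_moment[of 0 0 t s]
    by (subst Bochner_Integration.integral_diff) (simp_all add: gauss_moment_def)
  finally show ?thesis .
qed

lemma logistic_avg_0_zero: "logistic_avg 0 0 s = 1 / 2"
  using logistic_avg_0_minus[of 0 s] by simp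

lemma logistic_avg_0_at_top: "((\<lambda>t. logistic_avg 0 t s) \<longlongrightarrow> 1) at_top"
proof -
  have [measurable]: "logistic_D 0 \<in> borel_measurable borel"
    by (rule borel_measurable_continuous_onI) (simp add: continuous_logistic_D)
  have lim: "(logistic \<longlongrightarrow> 1) at_top"
    unfolding logistic_def[abs_def] by real_asymp
  have "((\<lambda>t. \<integral>z. std_normal_density z * z ^ 0 * logistic_D 0 (t + s * z) \<partial>lborel)
      \<longlongrightarrow> (\<integral>z. std_normal_density z * 1 \<partial>lborel)) at_top"
  proof (rule integral_dominated_convergence_at_top[where w=std_normal_density])
    show "AE z in lborel. ((\<lambda>t. std_normal_density z * z ^ 0 * logistic_D 0 (t + s * z))
        \<longlongrightarrow> std_normal_density z * 1) at_top"
    proof (intro AE_I2 tendsto_mult)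
      fix z
      have "filterlim (\<lambda>t. t + s * z) at_top at_top" by real_asymp
      then show "((\<lambda>t. logistic_D 0 (t + s * z)) \<longlongrightarrow> 1) at_top"
        unfolding logistic_D_simps by (rule filterlim_compose[OF lim])
    qed simp_all
    show "\<forall>\<^sub>F t in at_top. AE z in lborel.
        norm (std_normal_density z * z ^ 0 * logistic_D 0 (t + s * z)) \<le> std_normal_density z"
      using abs_logistic_D_le[of 0] by (auto simp: abs_mult intro!: always_eventually mult_left_le)
  qed simp_all
  then show ?thesis by (simp add: gauss_moment_def)
qed

lemma logistic_avg_0_less_1: "logistic_avg 0 t s < 1"
proof -
  have "logistic_avg 0 t s < logistic_avg 0 (t + 1) s"
    by (simp add: logistic_avg_0_mono_iff)
  also have "\<dots> \<le> 1"
  proof (rule tendsto_lowerbound[OF logistic_avg_0_at_top[of s]])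
    show "\<forall>\<^sub>F u in at_top. logistic_avg 0 (t + 1) s \<le> logistic_avg 0 u s"
      using eventually_gt_at_top[of "t + 1"]
      by eventually_elim (simp add: logistic_avg_0_mono_iff less_imp_le)
  qed simp
  finally show ?thesis .
qed

text \<open>The intermediate value theorem between the value 1/2 at 0 and the limit 1. Levels of at
  least 1/2 keep the curves in the range where \<open>log_slope\<close> is convex.\<close>

lemma ex_quantile:
  assumes "1 / 2 \<le> y" "y < 1"
  shows "\<exists>t\<ge>0. logistic_avg 0 t s = y"
proof -
  have "\<forall>\<^sub>F t in at_top. y < logistic_avg 0 t s \<and> 0 \<le> t"
    using order_tendstoD(1)[OF logistic_avg_0_at_top assms(2)] eventually_ge_at_top
    by (rule eventually_conj)
  then obtain T where T: "y < logistic_avg 0 T s" "0 \<le> T"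
    using eventually_happens[of _ "at_top :: real filter"] by auto
  have "continuous_on {0..T} (\<lambda>t. logistic_avg 0 t s)"
    using DERIV_logistic_avg[of 0 s] by (intro DERIV_atLeastAtMost_imp_continuous_on) auto
  then show ?thesis
    using IVT'[of "\<lambda>t. logistic_avg 0 t s" 0 y T] T assms by (auto simp: logistic_avg_0_zero)
qed

text \<open>For fixed \<open>a\<close> the comparison of \<open>logistic_avg 0 a s\<close> with
  \<open>y\<close> persists for nearby scales, and by monotonicity it decides on which side of
  \<open>a\<close> the curve lies.\<close>

lemma isCont_quantile:
  assumes q: "\<And>s. logistic_avg 0 (q s) s = y"
  shows "isCont q s"
  unfolding isCont_def
proof (rule order_tendstoI)
  fix a assume "a < q s"
  then have "logistic_avg 0 a s < y" using q[of s] logistic_avg_0_mono_iff by metis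
  with tendsto_logistic_avg[of 0 "\<lambda>_. a" a "at s" "\<lambda>s. s" s]
  have "\<forall>\<^sub>F s in at s. logistic_avg 0 a s < y"
    by (auto intro: order_tendstoD)
  then show "\<forall>\<^sub>F s in at s. a < q s"
    by eventually_elim (metis q logistic_avg_0_mono_iff)
next
  fix a assume "q s < a"
  then have "y < logistic_avg 0 a s" using q[of s] logistic_avg_0_mono_iff by metis
  with tendsto_logistic_avg[of 0 "\<lambda>_. a" a "at s" "\<lambda>s. s" s]
  have "\<forall>\<^sub>F s in at s. y < logistic_avg 0 a s"
    by (auto intro: order_tendstoD)
  then show "\<forall>\<^sub>F s in at s. q s < a"
    by eventually_elim (metis q logistic_avg_0_mono_iff)
qed

text \<open>Covers both orders of \<open>a\<close> and \<open>b\<close> and their equality. The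
  distance bound makes the intermediate point tend to \<open>a\<close> when \<open>b\<close>
  does.\<close>

lemma MVT_between:
  fixes f f' :: "real \<Rightarrow> real"
  assumes f: "\<And>x. (f has_real_derivative f' x) (at x)"
  shows "\<exists>x. \<bar>x - a\<bar> \<le> \<bar>b - a\<bar> \<and> f b - f a = (b - a) * f' x"
proof (cases a b rule: linorder_cases)
  case less
  obtain z where "a < z" "z < b" "f b - f a = (b - a) * f' z"
    using MVT2[OF less, of f f'] f by blast
  then show ?thesis by (intro exI[of _ z]) auto
next
  case greater
  obtain z where "b < z" "z < a" "f a - f b = (a - b) * f' z"
    using MVT2[OF greater, of f f'] f by blast
  then show ?thesis by (intro exI[of _ z]) (auto simp: algebra_simps)
qed auto

text \<open>
  The heat equation \<open>\<partial>L/\<partial>s = s \<cdot> \<partial>\<^sup>2L/\<partial>t\<^sup>2\<close> for \<open>L = logistic_avg 0\<close> turns into this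
  differential equation for the level curves of \<open>L\<close>.
\<close>

lemma DERIV_quantile:
  assumes q: "\<And>s. logistic_avg 0 (q s) s = y"
  shows "(q has_real_derivative - (s * log_slope s (q s))) (at s)"
proof -
  have dt: "((\<lambda>t. logistic_avg 0 t u) has_real_derivative logistic_avg 1 t u) (at t)" for t u
    using DERIV_logistic_avg[of 0 u t] by (simp add: One_nat_def)
  have ds: "((\<lambda>s. logistic_avg 0 t s) has_real_derivative u * logistic_avg 2 t u) (at u)" for t u
    using DERIV_logistic_D[of 0] DERIV_logistic_D[of 1]
    by (intro DERIV_gauss_avg_scale[of _ "logistic_D 1"] continuous_logistic_D abs_logistic_D_le)
       (auto simp: One_nat_def numeral_2_eq_2)
  \<comment> \<open>The zero increment of the average along the curve is split into a step in the
    mean at scale \<open>u\<close> and a step in the scale at mean \<open>q s\<close>. Joint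
    continuity of the partial derivatives then gives the limit.\<close>
  have "\<forall>u. \<exists>x. \<bar>x - q s\<bar> \<le> \<bar>q u - q s\<bar> \<and>
      logistic_avg 0 (q u) u - logistic_avg 0 (q s) u = (q u - q s) * logistic_avg 1 x u"
    using MVT_between[OF dt] by blast
  then obtain \<xi> where \<xi>: "\<And>u. \<bar>\<xi> u - q s\<bar> \<le> \<bar>q u - q s\<bar>"
    "\<And>u. logistic_avg 0 (q u) u - logistic_avg 0 (q s) u = (q u - q s) * logistic_avg 1 (\<xi> u) u"
    by metis
  have "\<forall>u. \<exists>x. \<bar>x - s\<bar> \<le> \<bar>u - s\<bar> \<and>
      logistic_avg 0 (q s) u - logistic_avg 0 (q s) s = (u - s) * (x * logistic_avg 2 (q s) x)"
    using MVT_between[OF ds] by blast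
  then obtain \<eta> where \<eta>: "\<And>u. \<bar>\<eta> u - s\<bar> \<le> \<bar>u - s\<bar>"
    "\<And>u. logistic_avg 0 (q s) u - logistic_avg 0 (q s) s = (u - s) * (\<eta> u * logistic_avg 2 (q s) (\<eta> u))"
    by metis
  have id: "((\<lambda>u. u) \<longlongrightarrow> s) (at s)" by (rule tendsto_ident_at)
  have "(q \<longlongrightarrow> q s) (at s)"
    using isCont_quantile[OF q] by (simp add: isCont_def)
  then have "((\<lambda>u. \<bar>q u - q s\<bar>) \<longlongrightarrow> 0) (at s)"
    by (auto intro!: tendsto_eq_intros)
  then have "((\<lambda>u. \<xi> u - q s) \<longlongrightarrow> 0) (at s)"
    by (rule Lim_null_comparison[rotated]) (use \<xi> in auto)
  then have \<xi>_lim: "(\<xi> \<longlongrightarrow> q s) (at s)" by (simp add: LIM_zero_iff)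
  have "((\<lambda>u. \<bar>u - s\<bar>) \<longlongrightarrow> 0) (at s)"
    by (auto intro!: tendsto_eq_intros)
  then have "((\<lambda>u. \<eta> u - s) \<longlongrightarrow> 0) (at s)"
    by (rule Lim_null_comparison[rotated]) (use \<eta> in auto)
  then have \<eta>_lim: "(\<eta> \<longlongrightarrow> s) (at s)" by (simp add: LIM_zero_iff)
  have pos: "0 < logistic_avg 1 t u" for t u by (rule logistic_avg_1_pos)
  have "((\<lambda>u. - (\<eta> u * logistic_avg 2 (q s) (\<eta> u)) / logistic_avg 1 (\<xi> u) u)
      \<longlongrightarrow> - (s * logistic_avg 2 (q s) s) / logistic_avg 1 (q s) s) (at s)"
    using pos[of "q s" s]
    by (intro tendsto_intros tendsto_logistic_avg \<eta>_lim \<xi>_lim id) auto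
  moreover have "\<forall>\<^sub>F u in at s. - (\<eta> u * logistic_avg 2 (q s) (\<eta> u)) / logistic_avg 1 (\<xi> u) u
      = (q u - q s) / (u - s)"
    unfolding eventually_at_filter
  proof (rule always_eventually, intro allI impI)
    fix u assume "u \<noteq> s"
    have "(q u - q s) * logistic_avg 1 (\<xi> u) u + (u - s) * (\<eta> u * logistic_avg 2 (q s) (\<eta> u)) = 0"
      using \<xi>(2)[of u] \<eta>(2)[of u] q[of u] q[of s] by linarith
    then show "- (\<eta> u * logistic_avg 2 (q s) (\<eta> u)) / logistic_avg 1 (\<xi> u) u = (q u - q s) / (u - s)"
      using \<open>u \<noteq> s\<close> pos[of "\<xi> u" u] by (simp add: divide_simps) (simp add: algebra_simps)
  qed
  ultimately have "((\<lambda>u. (q u - q s) / (u - s)) \<longlongrightarrow>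
      - (s * logistic_avg 2 (q s) s) / logistic_avg 1 (q s) s) (at s)"
    by (rule Lim_transform_eventually)
  then show ?thesis
    by (simp add: has_field_derivative_iff log_slope_def)
qed

lemma spacing_ratio_decreasing:
  assumes x: "0 \<le> x1" "x1 < x2" "x2 < x3" and s: "0 \<le> s" "s < s'"
    and eq: "logistic_avg 0 x1 s = logistic_avg 0 x1' s'" "logistic_avg 0 x2 s = logistic_avg 0 x2' s'"
      "logistic_avg 0 x3 s = logistic_avg 0 x3' s'"
  shows "(x3' - x2') / (x2' - x1') < (x3 - x2) / (x2 - x1)"
proof -
  \<comment> \<open>A level curve, chosen at every scale, that joins \<open>x\<close> at scale
    \<open>s\<close> to \<open>x'\<close> at scale \<open>s'\<close>.\<close>
  have ex: "\<exists>q. q s = x \<and> q s' = x' \<and> (\<forall>u. 0 \<le> q u \<and> logistic_avg 0 (q u) u = logistic_avg 0 x s)"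
    if "0 \<le> x" "logistic_avg 0 x s = logistic_avg 0 x' s'" for x x'
  proof -
    have "1 / 2 \<le> logistic_avg 0 x s"
      using that(1) logistic_avg_0_mono_iff[of x s 0] by (simp add: logistic_avg_0_zero not_less)
    then have "\<forall>u. \<exists>t\<ge>0. logistic_avg 0 t u = logistic_avg 0 x s"
      using ex_quantile logistic_avg_0_less_1 by blast
    then obtain q where q: "\<And>u. 0 \<le> q u \<and> logistic_avg 0 (q u) u = logistic_avg 0 x s" by metis
    have "q s = x" "q s' = x'"
      using q[of s] q[of s'] that(2) logistic_avg_0_eq_iff by metis+
    with q show ?thesis by blast
  qed
  obtain q1 where q1: "q1 s = x1" "q1 s' = x1'" "\<And>u. 0 \<le> q1 u" "\<And>u. logistic_avg 0 (q1 u) u = logistic_avg 0 x1 s"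
    using ex[OF _ eq(1)] x by auto
  obtain q2 where q2: "q2 s = x2" "q2 s' = x2'" "\<And>u. logistic_avg 0 (q2 u) u = logistic_avg 0 x2 s"
    using ex[OF _ eq(2)] x by auto
  obtain q3 where q3: "q3 s = x3" "q3 s' = x3'" "\<And>u. logistic_avg 0 (q3 u) u = logistic_avg 0 x3 s"
    using ex[OF _ eq(3)] x by auto
  have lt: "q1 u < q2 u" "q2 u < q3 u" for u
    using x q1(4)[of u] q2(3)[of u] q3(3)[of u] logistic_avg_0_mono_iff by metis+
  define \<rho> where "\<rho> u = (q3 u - q2 u) / (q2 u - q1 u)" for u
  define D where "D u = (- (u * log_slope u (q3 u)) - - (u * log_slope u (q2 u))) * (q2 u - q1 u)
    - (q3 u - q2 u) * (- (u * log_slope u (q2 u)) - - (u * log_slope u (q1 u)))" for u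
  have d\<rho>: "(\<rho> has_real_derivative D u / ((q2 u - q1 u) * (q2 u - q1 u))) (at u)" for u
    unfolding \<rho>_def[abs_def] D_def using lt[of u]
    by (intro DERIV_divide DERIV_diff DERIV_quantile[OF q1(4)] DERIV_quantile[OF q2(3)]
        DERIV_quantile[OF q3(3)]) auto
  have "\<rho> s' < \<rho> s"
  proof (rule DERIV_neg_imp_decreasing_open[OF s(2), of \<rho>])
    \<comment> \<open>Convexity requires a positive scale, whereas \<open>s\<close> may be 0; a
      negative derivative on the open interval suffices.\<close>
    fix u assume "s < u" "u < s'"
    then have u: "0 < u" using s by linarith
    have "(log_slope u (q2 u) - log_slope u (q1 u)) * (q3 u - q2 u)
        < (log_slope u (q3 u) - log_slope u (q2 u)) * (q2 u - q1 u)"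
      using log_slope_strictly_convex[OF u q1(3) lt[of u]] lt[of u] by (simp add: divide_simps)
    then have "u * ((log_slope u (q2 u) - log_slope u (q1 u)) * (q3 u - q2 u))
        < u * ((log_slope u (q3 u) - log_slope u (q2 u)) * (q2 u - q1 u))"
      using u by simp
    then have "D u < 0" unfolding D_def by (simp add: algebra_simps)
    then have "D u / ((q2 u - q1 u) * (q2 u - q1 u)) < 0"
      using lt[of u] by (intro divide_neg_pos) auto
    then show "\<exists>y. (\<rho> has_real_derivative y) (at u) \<and> y < 0"
      using d\<rho>[of u] by blast
  next
    show "continuous_on {s..s'} \<rho>"
      using d\<rho> by (meson DERIV_isCont continuous_at_imp_continuous_on)
  qed
  then show ?thesis unfolding \<rho>_def q1(1,2) q2(1,2) q3(1,2) .
qed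

section \<open>Counting agreements under an affine change of the mean\<close>

lemma no_four_agreements:
  assumes s: "0 \<le> s" "s < s'" and k: "0 < k" and t: "t1 < t2" "t2 < t3" "t3 < t4"
    and eq: "\<And>t. t \<in> {t1, t2, t3, t4} \<Longrightarrow> logistic_avg 0 t s = logistic_avg 0 (c + k * t) s'"
  shows False
proof -
  have reflect: "logistic_avg 0 (- t) s = logistic_avg 0 (- c + k * - t) s'"
    if "logistic_avg 0 t s = logistic_avg 0 (c + k * t) s'" for c t
    using that logistic_avg_0_minus[of "c + k * t" s'] by (simp add: logistic_avg_0_minus)
  have three: False
    if "0 \<le> x" "x < y" "y < z" and "logistic_avg 0 x s = logistic_avg 0 (c + k * x) s'"
      "logistic_avg 0 y s = logistic_avg 0 (c + k * y) s'"
      "logistic_avg 0 z s = logistic_avg 0 (c + k * z) s'" for c x y z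
  proof -
    have "((c + k * z) - (c + k * y)) / ((c + k * y) - (c + k * x)) = (z - y) / (y - x)"
      using k that by (simp add: right_diff_distrib[symmetric])
    then show False using spacing_ratio_decreasing[OF that(1-3) s that(4-6)] by simp
  qed
  \<comment> \<open>The level curve through 0 stays at 0, so 0 serves as the first of three points.
    It stays fixed while the affine map would send it to \<open>c\<close>, and the smaller ratio
    forces \<open>c\<close> to be positive.\<close>
  have two: "0 < c"
    if "0 < x" "x < y" and "logistic_avg 0 x s = logistic_avg 0 (c + k * x) s'"
      "logistic_avg 0 y s = logistic_avg 0 (c + k * y) s'" for c x y
  proof -
    have "logistic_avg 0 0 s < logistic_avg 0 x s" using that(1) by (simp add: logistic_avg_0_mono_iff)
    then have pos: "0 < c + k * x"
      using that logistic_avg_0_mono_iff[of 0 s' "c + k * x"] by (simp add: logistic_avg_0_zero)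
    have "logistic_avg 0 0 s = logistic_avg 0 0 s'" by (simp add: logistic_avg_0_zero)
    from spacing_ratio_decreasing[OF order_refl that(1,2) s this that(3,4)]
    have "(k * (y - x)) / (c + k * x) < (y - x) / x" by (simp add: algebra_simps)
    then have "(y - x) * (k * x) < (y - x) * (c + k * x)"
      using pos that by (simp add: divide_simps split: if_splits)
    then show "0 < c" using that by simp
  qed
  \<comment> \<open>Either three of the points lie in one closed half-line, or two lie strictly on
    each side of 0.\<close>
  consider "0 \<le> t2" | "t3 \<le> 0" | "t2 < 0" "0 < t3" by linarith
  then show False
  proof cases
    case 1 then show False using three[of t2 t3 t4 c] t eq by simp
  next
    case 2 then show False
      using three[of "- t3" "- t2" "- t1" "- c"] t eq reflect by simp
  next
    case 3
    then have "0 < c" using two[of t3 t4 c] t eq by simp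
    moreover have "0 < - c"
      using 3 two[of "- t2" "- t1" "- c"] t eq reflect[of t1 c] reflect[of t2 c] by simp
    ultimately show False by linarith
  qed
qed

lemma ex_four_sorted:
  fixes S :: "real set"
  assumes "\<not> (finite S \<and> card S \<le> 3)"
  shows "\<exists>x1 x2 x3 x4. {x1, x2, x3, x4} \<subseteq> S \<and> x1 < x2 \<and> x2 < x3 \<and> x3 < x4"
proof -
  obtain T where T: "T \<subseteq> S" "card T = 4" "finite T"
  proof (cases "finite S")
    case True
    then show ?thesis using assms obtain_subset_with_card_n[of 4 S] that by auto
  next
    case False
    then show ?thesis using infinite_arbitrarily_large[of S 4] that by auto
  qed
  define xs where "xs = sorted_list_of_set T"
  have "length xs = 4" "set xs = T" using T by (simp_all add: xs_def)
  moreover have "sorted_wrt (<) xs" by (simp add: xs_def)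
  ultimately have "xs ! 0 < xs ! 1 \<and> xs ! 1 < xs ! 2 \<and> xs ! 2 < xs ! 3"
    and "{xs ! 0, xs ! 1, xs ! 2, xs ! 3} \<subseteq> T"
    by (auto simp: sorted_wrt_iff_nth_less intro!: nth_mem)
  then show ?thesis using T by blast
qed

text \<open>Monotonicity in the mean gives \<open>b\<close> and \<open>b'\<close> the same sign.
  Distinct scales are then excluded by \<open>no_four_agreements\<close>, and with equal scales two
  points determine the affine function.\<close>

lemma logistic_avg_parameters_eq:
  fixes a b a' b' \<sigma> \<sigma>' :: real
  assumes \<sigma>: "0 \<le> \<sigma>" "0 \<le> \<sigma>'"
    and S: "\<not> (finite S \<and> card S \<le> 3)"
    and eq: "\<And>x. x \<in> S \<Longrightarrow>
      logistic_avg 0 (a + b * x) (\<bar>b\<bar> * \<sigma>) = logistic_avg 0 (a' + b' * x) (\<bar>b'\<bar> * \<sigma>')"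
  shows "a = a' \<and> b = b' \<and> \<bar>b\<bar> * \<sigma> = \<bar>b'\<bar> * \<sigma>'"
proof -
  obtain x1 x2 x3 x4 where x: "x1 < x2" "x2 < x3" "x3 < x4" and xS: "{x1, x2, x3, x4} \<subseteq> S"
    using ex_four_sorted[OF S] by blast
  define s s' where "s = \<bar>b\<bar> * \<sigma>" and "s' = \<bar>b'\<bar> * \<sigma>'"
  have s: "0 \<le> s" "0 \<le> s'" using \<sigma> by (simp_all add: s_def s'_def)
  have eq4: "logistic_avg 0 (a + b * x) s = logistic_avg 0 (a' + b' * x) s'"
    if "x \<in> {x1, x2, x3, x4}" for x
    using eq xS that unfolding s_def s'_def by blast
  have "u < v \<longleftrightarrow> u' < v'"
    if "logistic_avg 0 u s = logistic_avg 0 u' s'" "logistic_avg 0 v s = logistic_avg 0 v' s'" for u v u' v'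
    using that logistic_avg_0_mono_iff by metis
  from this[OF eq4[of x1] eq4[of x2]] this[OF eq4[of x2] eq4[of x1]]
  have "a + b * x1 < a + b * x2 \<longleftrightarrow> a' + b' * x1 < a' + b' * x2"
    "a + b * x2 < a + b * x1 \<longleftrightarrow> a' + b' * x2 < a' + b' * x1" by simp_all
  then have sign: "0 < b \<longleftrightarrow> 0 < b'" "b < 0 \<longleftrightarrow> b' < 0"
    using x(1) by (auto simp: mult_less_cancel_left)
  have less: False
    if s: "0 \<le> s" "s < s'" and sign: "0 < b \<longleftrightarrow> 0 < b'" "b < 0 \<longleftrightarrow> b' < 0" "b \<noteq> 0"
      and eq4: "\<And>x. x \<in> {x1, x2, x3, x4} \<Longrightarrow>
        logistic_avg 0 (a + b * x) s = logistic_avg 0 (a' + b' * x) s'"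
    for a b a' b' s s' :: real
  proof -
    \<comment> \<open>The affine map that carries \<open>a + b * x\<close> to
      \<open>a' + b' * x\<close>.\<close>
    define k c where "k = b' / b" and "c = a' - k * a"
    have k: "0 < k" unfolding k_def using sign by (metis divide_neg_neg divide_pos_pos linorder_neqE_linordered_idom)
    have c: "c + k * (a + b * x) = a' + b' * x" for x
      unfolding c_def k_def using sign by (simp add: field_simps)
    have agree: "logistic_avg 0 t s = logistic_avg 0 (c + k * t) s'"
      if "t \<in> {a + b * x1, a + b * x2, a + b * x3, a + b * x4}" for t
      using that eq4[of x1] eq4[of x2] eq4[of x3] eq4[of x4] by (auto simp: c)
    show False
    proof (cases "0 < b")
      case True
      then show False
        using no_four_agreements[OF s k, of "a + b * x1" "a + b * x2" "a + b * x3" "a + b * x4" c]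
          x agree by simp
    next
      case False
      then show False
        using no_four_agreements[OF s k, of "a + b * x4" "a + b * x3" "a + b * x2" "a + b * x1" c]
          x agree sign(3) by auto
    qed
  qed
  have "s = s'"
  proof (cases "b = 0")
    \<comment> \<open>If \<open>b = 0\<close>, the sign comparison gives \<open>b' = 0\<close>, so
      both scales are 0.\<close>
    case True
    then show ?thesis using sign by (simp add: s_def s'_def)
  next
    case False
    then have "b' \<noteq> 0" using sign by auto
    then show ?thesis
      using less[of s s' b b' a a'] less[of s' s b' b a' a] s sign False eq4
      by (metis linorder_neqE_linordered_idom)
  qed
  then have "a + b * x1 = a' + b' * x1" "a + b * x2 = a' + b' * x2"
    using eq4[of x1] eq4[of x2] by (simp_all add: logistic_avg_0_eq_iff)
  then have "(b - b') * (x2 - x1) = 0" "a + b * x1 = a' + b' * x1" by (simp_all add: algebra_simps)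
  then show ?thesis using \<open>s = s'\<close> x(1) by (simp add: s_def s'_def)
qed

section \<open>Identifiability\<close>

lemma integral_logistic_centered_normal:
  assumes v: "0 \<le> v"
  shows "(\<integral>u. logistic (a + b * u) \<partial>centered_normal v) = logistic_avg 0 a (\<bar>b\<bar> * sqrt v)"
proof -
  have [measurable]: "logistic \<in> borel_measurable borel"
    using continuous_logistic_D[of 0] by (intro borel_measurable_continuous_onI) (simp add: logistic_D_simps)
  show ?thesis
  proof (cases "v = 0")
    case True
    have "(\<integral>u. logistic (a + b * u) \<partial>return borel 0) = logistic a"
      by (subst integral_return) auto
    then show ?thesis
      using True by (simp add: centered_normal_def gauss_moment_def logistic_D_simps)
  next
    case False
    \<comment> \<open>The substitution \<open>u = c * z\<close> takes the sign of \<open>b\<close>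
      into \<open>c\<close>, which turns \<open>b * c\<close> into the nonnegative scale.\<close>
    define c where "c = (if 0 \<le> b then sqrt v else - sqrt v)"
    have c: "\<bar>c\<bar> = sqrt v" "c \<noteq> 0" "b * c = \<bar>b\<bar> * sqrt v" "c\<^sup>2 = v"
      using False v by (auto simp: c_def)
    have "(\<integral>u. logistic (a + b * u) \<partial>centered_normal v)
        = (\<integral>u. normal_density 0 (sqrt v) u * logistic (a + b * u) \<partial>lborel)"
      using False by (simp add: centered_normal_def integral_density)
    also have "\<dots> = sqrt v * (\<integral>z. normal_density 0 (sqrt v) (c * z) * logistic (a + b * (c * z)) \<partial>lborel)"
      using lborel_integral_real_affine[OF c(2), of "\<lambda>u. normal_density 0 (sqrt v) u * logistic (a + b * u)" 0]
      by (simp add: c)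
    also have "\<dots> = (\<integral>z. sqrt v * (normal_density 0 (sqrt v) (c * z) * logistic (a + b * (c * z))) \<partial>lborel)"
      by simp
    also have "\<dots> = (\<integral>z. std_normal_density z * z ^ 0 * logistic_D 0 (a + \<bar>b\<bar> * sqrt v * z) \<partial>lborel)"
    proof (rule Bochner_Integration.integral_cong)
      fix z
      have "sqrt v * normal_density 0 (sqrt v) (c * z) = std_normal_density z"
        using False v c by (simp add: normal_density_def power_mult_distrib real_sqrt_mult)
      then show "sqrt v * (normal_density 0 (sqrt v) (c * z) * logistic (a + b * (c * z)))
          = std_normal_density z * z ^ 0 * logistic_D 0 (a + \<bar>b\<bar> * sqrt v * z)"
        by (simp add: logistic_D_simps c(3) flip: mult.assoc)
    qed simp
    finally show ?thesis by (simp add: gauss_moment_def)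
  qed
qed

section \<open>The joint law of surrogate and response\<close>

context berkson_logistic
begin

definition response_prob :: "real \<Rightarrow> real" where
  "response_prob x = logistic_avg 0 (fst \<beta> + snd \<beta> * x) (\<bar>snd \<beta>\<bar> * sqrt \<tau>sq)"

lemma response_prob_bounds: "0 \<le> response_prob x" "response_prob x \<le> 1"
proof -
  show "response_prob x \<le> 1"
    unfolding response_prob_def using logistic_avg_0_less_1 by (simp add: less_imp_le)
  show "0 \<le> response_prob x"
    unfolding response_prob_def gauss_moment_def
    by (intro integral_nonneg_AE AE_I2 mult_nonneg_nonneg)
       (auto simp: logistic_D_simps less_imp_le logistic_bounds)
qed

lemma measurable_response_prob [measurable]: "response_prob \<in> borel_measurable borel"
proof (rule borel_measurable_continuous_onI)
  show "continuous_on UNIV response_prob"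
    unfolding response_prob_def continuous_on_def
    by (intro ballI tendsto_logistic_avg tendsto_intros) auto
qed

text \<open>States in integrated form that \<open>response_prob\<close> is the conditional
  probability of response 1 given the surrogate. The logistic model enters through the conditional
  expectation, and independence of the error allows the error to be integrated out by
  Fubini.\<close>

lemma prob_response_1:
  assumes B [measurable]: "B \<in> sets borel"
  shows "measure (distr M borel (\<lambda>\<omega>. (Xobs 1 \<omega>, Y 1 \<omega>))) (B \<times> {1})
       = (\<integral>x\<in>B. response_prob x \<partial>distr M borel (Xobs 1))"
proof -
  have [measurable]: "Xobs 1 \<in> borel_measurable M" "X 1 \<in> borel_measurable M"
    "U 1 \<in> borel_measurable M" "Y 1 \<in> borel_measurable M"
    using rv_Xobs rv_X rv_U rv_Y by auto
  have [measurable]: "logistic \<in> borel_measurable borel"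
    using continuous_logistic_D[of 0] by (intro borel_measurable_continuous_onI) (simp add: logistic_D_simps)
  define F where "F = vimage_algebra (space M) (\<lambda>\<omega>. (Xobs 1 \<omega>, X 1 \<omega>)) (borel :: (real \<times> real) measure)"
  define E where "E = {\<omega> \<in> space M. Y 1 \<omega> = 1}"
  define A where "A = {\<omega> \<in> space M. Xobs 1 \<omega> \<in> B}"
  define f where "f \<omega> = logistic (fst \<beta> + snd \<beta> * X 1 \<omega>)" for \<omega>
  have [measurable]: "E \<in> sets M" "A \<in> sets M" unfolding E_def A_def by measurable
  have [measurable]: "f \<in> borel_measurable M" unfolding f_def by measurable
  have pair: "(\<lambda>\<omega>. (Xobs 1 \<omega>, X 1 \<omega>)) \<in> measurable M (borel :: (real \<times> real) measure)"
    by measurable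
  have sub: "subalgebra M F"
    using pair unfolding subalgebra_def F_def measurable_iff_sets by auto
  interpret F: finite_measure_subalgebra M F
    by standard (rule sub)
  \<comment> \<open>An event about the surrogate alone belongs to the conditioning algebra, so the
    conditional expectation may replace the indicator under the integral over
    \<open>A\<close>.\<close>
  have A_F: "A \<in> sets F"
  proof -
    have "A = (\<lambda>\<omega>. (Xobs 1 \<omega>, X 1 \<omega>)) -` (B \<times> UNIV) \<inter> space M" by (auto simp: A_def)
    moreover have "B \<times> UNIV \<in> sets (borel :: (real \<times> real) measure)"
      unfolding borel_prod[symmetric] by simp
    ultimately show ?thesis unfolding F_def by (auto intro: in_vimage_algebra)
  qed
  have B1: "B \<times> {1} \<in> sets (borel :: (real \<times> real) measure)"
    unfolding borel_prod[symmetric] by simp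
  have "measure (distr M borel (\<lambda>\<omega>. (Xobs 1 \<omega>, Y 1 \<omega>))) (B \<times> {1}) = measure M (A \<inter> E)"
    by (subst measure_distr[OF _ B1]) (auto intro!: arg_cong[where f="measure M"] simp: A_def E_def)
  also have "\<dots> = (\<integral>\<omega>\<in>A. indicator E \<omega> \<partial>M)"
    unfolding set_lebesgue_integral_def by (simp flip: indicator_inter_arith)
  also have "\<dots> = (\<integral>\<omega>\<in>A. real_cond_exp M F (indicator E) \<omega> \<partial>M)"
    by (rule F.real_cond_exp_intA[OF _ A_F]) (simp add: emeasure_eq_measure)
  also have "\<dots> = (\<integral>\<omega>\<in>A. f \<omega> \<partial>M)"
  proof (rule set_lebesgue_integral_cong_AE)
    show "AE \<omega>\<in>A in M. real_cond_exp M F (indicator E) \<omega> = f \<omega>"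
      using response_logistic[of 1] unfolding F_def E_def f_def logistic_def by auto
  qed measurable
  also have "\<dots> = (\<integral>\<omega>. indicator B (Xobs 1 \<omega>) * logistic (fst \<beta> + snd \<beta> * (Xobs 1 \<omega> + U 1 \<omega>)) \<partial>M)"
    unfolding set_lebesgue_integral_def f_def
    by (rule Bochner_Integration.integral_cong) (auto simp: A_def true_regressor indicator_def)
  also have "\<dots> = (\<integral>p. indicator B (fst p) * logistic (fst \<beta> + snd \<beta> * (fst p + snd p))
      \<partial>distr M (borel \<Otimes>\<^sub>M borel) (\<lambda>\<omega>. (Xobs 1 \<omega>, U 1 \<omega>)))"
    by (subst integral_distr) (auto simp: o_def)
  also have "\<dots> = (\<integral>p. indicator B (fst p) * logistic (fst \<beta> + snd \<beta> * (fst p + snd p))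
      \<partial>(distr M borel (Xobs 1) \<Otimes>\<^sub>M distr M borel (U 1)))"
    using error_indep[of 1] by (simp add: indep_var_distribution_eq)
  also have "\<dots> = (\<integral>x. \<integral>u. indicator B x * logistic (fst \<beta> + snd \<beta> * (x + u))
      \<partial>distr M borel (U 1) \<partial>distr M borel (Xobs 1))"
  proof -
    interpret X: prob_space "distr M borel (Xobs 1)" by (rule prob_space_distr) simp
    interpret U: prob_space "distr M borel (U 1)" by (rule prob_space_distr) simp
    interpret P: pair_prob_space "distr M borel (Xobs 1)" "distr M borel (U 1)" ..
    have "integrable (distr M borel (Xobs 1) \<Otimes>\<^sub>M distr M borel (U 1))
        (\<lambda>p. indicator B (fst p) * logistic (fst \<beta> + snd \<beta> * (fst p + snd p)))"
    proof (rule P.integrable_const_bound[where B=1])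
      show "AE p in distr M borel (Xobs 1) \<Otimes>\<^sub>M distr M borel (U 1).
          norm (indicator B (fst p) * logistic (fst \<beta> + snd \<beta> * (fst p + snd p))) \<le> 1"
        using logistic_bounds by (auto simp: indicator_def less_imp_le abs_of_pos intro!: AE_I2)
    qed measurable
    from P.integral_fst'[OF this] show ?thesis by simp
  qed
  also have "\<dots> = (\<integral>x. indicator B x * response_prob x \<partial>distr M borel (Xobs 1))"
  proof (rule Bochner_Integration.integral_cong)
    fix x
    have "(\<integral>u. logistic (fst \<beta> + snd \<beta> * (x + u)) \<partial>distr M borel (U 1)) = response_prob x"
      using integral_logistic_centered_normal[OF \<tau>sq_nonneg, of "fst \<beta> + snd \<beta> * x" "snd \<beta>"]
      by (simp add: error_normal response_prob_def algebra_simps)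
    then show "(\<integral>u. indicator B x * logistic (fst \<beta> + snd \<beta> * (x + u)) \<partial>distr M borel (U 1))
        = indicator B x * response_prob x"
      by simp
  qed simp
  finally show ?thesis by (simp add: set_lebesgue_integral_def)
qed

end

theorem theorem6:
  fixes M :: "'a measure" and M' :: "'b measure"
    and Xobs X U Y :: "nat \<Rightarrow> 'a \<Rightarrow> real"
    and Xobs' X' U' Y' :: "nat \<Rightarrow> 'b \<Rightarrow> real"
    and \<beta> \<beta>' :: "real \<times> real"
    and \<tau>sq \<tau>sq' :: real
  assumes "berkson_logistic M Xobs X U Y \<beta> \<tau>sq"
    and "berkson_logistic M' Xobs' X' U' Y' \<beta>' \<tau>sq'"
    and "\<not> (\<exists>A :: real set. finite A \<and> card A \<le> 3 \<and>
                measure M {\<omega> \<in> space M. Xobs 1 \<omega> \<in> A} = 1)"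
    and "distr M (borel :: (real \<times> real) measure) (\<lambda>\<omega>. (Xobs 1 \<omega>, Y 1 \<omega>))
       = distr M' borel (\<lambda>\<omega>. (Xobs' 1 \<omega>, Y' 1 \<omega>))"
  shows "\<beta> = \<beta>' \<and> (snd \<beta>)\<^sup>2 * \<tau>sq = (snd \<beta>')\<^sup>2 * \<tau>sq'"
proof -
  interpret A: berkson_logistic M Xobs X U Y \<beta> \<tau>sq by fact
  interpret B: berkson_logistic M' Xobs' X' U' Y' \<beta>' \<tau>sq' by fact
  note joint = assms(4)
  have [measurable]: "Xobs 1 \<in> borel_measurable M" "Y 1 \<in> borel_measurable M"
    "Xobs' 1 \<in> borel_measurable M'" "Y' 1 \<in> borel_measurable M'"
    using A.rv_Xobs A.rv_Y B.rv_Xobs B.rv_Y by auto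
  let ?\<mu> = "distr M borel (Xobs 1)"
  have "?\<mu> = distr (distr M (borel :: (real \<times> real) measure) (\<lambda>\<omega>. (Xobs 1 \<omega>, Y 1 \<omega>))) borel fst"
    by (subst distr_distr) (auto simp: o_def borel_prod[symmetric])
  also have "\<dots> = distr M' borel (Xobs' 1)"
    unfolding joint by (subst distr_distr) (auto simp: o_def borel_prod[symmetric])
  finally have \<mu>: "?\<mu> = distr M' borel (Xobs' 1)" .
  interpret \<mu>: prob_space ?\<mu> by (rule A.prob_space_distr) simp
  \<comment> \<open>Both response probabilities have the same integral over every Borel set with
    respect to the common law of the surrogates.\<close>
  have "AE x in ?\<mu>. A.response_prob x = B.response_prob x"
  proof (rule density_unique_real)
    show "integrable ?\<mu> A.response_prob" "integrable ?\<mu> B.response_prob"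
      using A.response_prob_bounds B.response_prob_bounds
      by (auto intro!: \<mu>.integrable_const_bound[where B=1] AE_I2)
    fix C assume "C \<in> sets ?\<mu>"
    then have C: "C \<in> sets borel" by simp
    show "(\<integral>x\<in>C. A.response_prob x \<partial>?\<mu>) = (\<integral>x\<in>C. B.response_prob x \<partial>?\<mu>)"
      using A.prob_response_1[OF C] B.prob_response_1[OF C] joint \<mu> by simp
  qed
  then have AE: "AE \<omega> in M. A.response_prob (Xobs 1 \<omega>) = B.response_prob (Xobs 1 \<omega>)"
    by (subst (asm) AE_distr_iff) auto
  \<comment> \<open>The agreement set carries the whole law of the surrogate, so the hypothesis on
    that law provides at least four agreement points.\<close>
  define S where "S = {x. A.response_prob x = B.response_prob x}"
  have "measure M {\<omega> \<in> space M. Xobs 1 \<omega> \<in> S} = 1"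
    using AE unfolding S_def by (subst A.prob_Collect_eq_1) auto
  then have S: "\<not> (finite S \<and> card S \<le> 3)" using assms(3) by blast
  have eq: "fst \<beta> = fst \<beta>' \<and> snd \<beta> = snd \<beta>' \<and> \<bar>snd \<beta>\<bar> * sqrt \<tau>sq = \<bar>snd \<beta>'\<bar> * sqrt \<tau>sq'"
    using A.\<tau>sq_nonneg B.\<tau>sq_nonneg
    by (intro logistic_avg_parameters_eq[OF _ _ S])
       (auto simp: S_def A.response_prob_def B.response_prob_def)
  then have "(\<bar>snd \<beta>\<bar> * sqrt \<tau>sq)\<^sup>2 = (\<bar>snd \<beta>'\<bar> * sqrt \<tau>sq')\<^sup>2" by metis
  then have "(snd \<beta>)\<^sup>2 * \<tau>sq = (snd \<beta>')\<^sup>2 * \<tau>sq'"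
    using A.\<tau>sq_nonneg B.\<tau>sq_nonneg by (simp add: power_mult_distrib)
  with eq show ?thesis by (simp add: prod_eq_iff)
qed

end
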